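(* Let $V$ be an 8-dimensional real vector space with a hyper-Hermitian structure $(g,J_1,J_2,J_3)$, let $\mathfrak R^{Sp(2)}$ be the space of hyper-Kähler curvature-type tensors on $V$, and let $\mathcal C\subset\mathfrak R^{Sp(2)}$ be the set of those $K$ that are given by the discriminant of a cubic polynomial (see context). An element $K\in\mathfrak R^{Sp(2)}$ belongs to $\mathcal C$ if and only if the endomorphism $\mathcal T_K$ of $sp(2)$ satisfies the following two conditions: (I) $(2\mathcal T_K-7\,\mathrm{Id})(2\mathcal T_K+3\,\mathrm{Id})=0$; (II) for all $A,B\in sp(2)$, $$[\mathcal T_KA,\mathcal T_KB]-\mathcal T_K[\mathcal T_KA,B]=\tfrac32\big(\mathcal T_K[A,B]-[A,\mathcal T_KB]\big).$$
   Context: A hyper-Hermitian structure on the real 8-dimensional space $V$ is a positive definite inner product $g$ and endomorphisms $J_1,J_2,J_3$ with $J_1J_2=-J_2J_1=J_3$, $J_s^2=-\mathrm{Id}$, $g(J_sx,J_sy)=g(x,y)$. All tensors are extended complex-linearly to $V^{\mathbb C}=V\otimes\mathbb C$. Let $W\subset V^{\mathbb C}$ be the $i$-eigenspace of $J_1$, so $V^{\mathbb C}=W\oplus\overline W$. The complex 2-form $\pi$ is determined by $g(x,y)=\pi(x,J_2y)$. A basis $e_1,\dots,e_4$ of $W$ is called $Sp(2)$-adapted if $e_3=J_2\overline{e_1}$, $e_4=J_2\overline{e_2}$ and $\pi|_W=e^1\wedge e^3+e^2\wedge e^4$ (equivalently, also $g(e_\alpha,\overline{e_\beta})=\delta_{\alpha\beta}$).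 $sp(2)=\{A\in \mathrm{End}(V): g(Ax,y)+g(x,Ay)=0,\ AJ_s=J_sA,\ s=1,2,3\}$, with the commutator bracket. $\mathfrak R^{Sp(2)}$ is the space of all $K\in\Lambda^2V^*\otimes\Lambda^2V^*$ with $K(x,y,z,w)+K(y,z,x,w)+K(z,x,y,w)=0$ and $K(x,y,J_sz,J_sw)=K(x,y,z,w)$ for $s=1,2,3$. For $K\in\mathfrak R^{Sp(2)}$, $\mathcal T_K:sp(2)\to sp(2)$ is defined by $g(\mathcal T_K(A)x,y)=\frac12\sum_{a=1}^8K(x,y,h_a,Ah_a)$, where $\{h_a\}$ is any $g$-orthonormal basis of $V$. For $K\in\mathfrak R^{Sp(2)}$ put $S(x,y,z,w)=\frac12\big(K(x,J_2y,z,J_2w)-K(x,J_3y,z,J_3w)\big)$; its restriction to $W$ is totally symmetric. $\mathcal C$ is the set of all $K\in\mathfrak R^{Sp(2)}$ for which there is an $Sp(2)$-adapted basis $\{e_\alpha\}$ of $W$ such that for all $x=\sum_\alpha x^\alpha e_\alpha\in W$ $$S(x,x,x,x)=-18x^1x^2x^3x^4+4\sqrt3\,x^1(x^4)^3-4\sqrt3\,(x^2)^3x^3+3(x^2)^2(x^4)^2-9(x^1)^2(x^3)^2 .$$ *)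

theory Defs
  imports "HOL-Analysis.Analysis"
begin

text \<open>
  A real vector space with a positive definite inner product \<open>g\<close> is a type of class
  \<open>euclidean_space\<close>, with \<open>g x y = x \<bullet> y\<close>. In finite dimension every linear map is bounded, so
  \<open>End(V)\<close> is the type \<open>'v \<Rightarrow>\<^sub>L 'v\<close>.
\<close>

definition hyper_hermitian ::
    "('v::euclidean_space \<Rightarrow>\<^sub>L 'v) \<Rightarrow> ('v \<Rightarrow>\<^sub>L 'v) \<Rightarrow> ('v \<Rightarrow>\<^sub>L 'v) \<Rightarrow> bool" where
  "hyper_hermitian J1 J2 J3 \<longleftrightarrow>
     J1 o\<^sub>L J2 = J3 \<and> - (J2 o\<^sub>L J1) = J3 \<and>
     (\<forall>J\<in>{J1, J2, J3}. J o\<^sub>L J = - id_blinfun \<and> (\<forall>x y. J x \<bullet> J y = x \<bullet> y))"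

definition bracket ::
    "('v::euclidean_space \<Rightarrow>\<^sub>L 'v) \<Rightarrow> ('v \<Rightarrow>\<^sub>L 'v) \<Rightarrow> ('v \<Rightarrow>\<^sub>L 'v)" where
  "bracket A B = (A o\<^sub>L B) - (B o\<^sub>L A)"

definition sp2 ::
    "('v::euclidean_space \<Rightarrow>\<^sub>L 'v) \<Rightarrow> ('v \<Rightarrow>\<^sub>L 'v) \<Rightarrow> ('v \<Rightarrow>\<^sub>L 'v) \<Rightarrow> ('v \<Rightarrow>\<^sub>L 'v) set" where
  "sp2 J1 J2 J3 =
     {A. (\<forall>x y. blinfun_apply A x \<bullet> y + x \<bullet> blinfun_apply A y = 0) \<and>
         (\<forall>J\<in>{J1, J2, J3}. A o\<^sub>L J = J o\<^sub>L A)}"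

text \<open>Covariant 4-tensors are curried functions; the first six conjuncts say \<open>K \<in> \<Lambda>\<^sup>2V* \<otimes> \<Lambda>\<^sup>2V*\<close>.\<close>

definition curv_sp2 ::
    "('v::euclidean_space \<Rightarrow>\<^sub>L 'v) \<Rightarrow> ('v \<Rightarrow>\<^sub>L 'v) \<Rightarrow> ('v \<Rightarrow>\<^sub>L 'v) \<Rightarrow>
     ('v \<Rightarrow> 'v \<Rightarrow> 'v \<Rightarrow> 'v \<Rightarrow> real) set" where
  "curv_sp2 J1 J2 J3 =
     {K. (\<forall>y z w. linear (\<lambda>x. K x y z w)) \<and> (\<forall>x z w. linear (\<lambda>y. K x y z w)) \<and>
         (\<forall>x y w. linear (\<lambda>z. K x y z w)) \<and> (\<forall>x y z. linear (\<lambda>w. K x y z w)) \<and>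
         (\<forall>x y z w. K y x z w = - K x y z w) \<and>
         (\<forall>x y z w. K x y w z = - K x y z w) \<and>
         (\<forall>x y z w. K x y z w + K y z x w + K z x y w = 0) \<and>
         (\<forall>J\<in>{J1, J2, J3}. \<forall>x y z w. K x y (J z) (J w) = K x y z w)}"

text \<open>
  The sum runs over the standard basis; the lemma \<open>curv_op_inner\<close> below shows that every
  orthonormal basis gives the same operator, and that it exists.
\<close>

definition curv_op ::
    "('v::euclidean_space \<Rightarrow> 'v \<Rightarrow> 'v \<Rightarrow> 'v \<Rightarrow> real) \<Rightarrow> ('v \<Rightarrow>\<^sub>L 'v) \<Rightarrow> ('v \<Rightarrow>\<^sub>L 'v)" where
  "curv_op K A =
     (THE T :: 'v \<Rightarrow>\<^sub>L 'v. \<forall>x y. T x \<bullet> y = 1/2 * (\<Sum>h\<in>Basis. K x y h (A h)))"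

text \<open>The complexification \<open>V \<otimes> \<complex>\<close>: the pair \<open>(a, b)\<close> stands for \<open>a + i b\<close>.\<close>

type_synonym 'v complexified = "'v \<times> 'v"

definition cscale :: "complex \<Rightarrow> 'v::real_vector complexified \<Rightarrow> 'v complexified"
    (infixr \<open>*\<^sub>C\<close> 75) where
  "c *\<^sub>C z = (Re c *\<^sub>R fst z - Im c *\<^sub>R snd z, Re c *\<^sub>R snd z + Im c *\<^sub>R fst z)"

global_interpretation cV: vector_space "cscale :: complex \<Rightarrow> 'v::real_vector complexified \<Rightarrow> _"
  by unfold_locales (auto simp: cscale_def algebra_simps)

definition cconj :: "'v::real_vector complexified \<Rightarrow> 'v complexified" where
  "cconj z = (fst z, - snd z)"

definition cmap :: "('v::euclidean_space \<Rightarrow>\<^sub>L 'v) \<Rightarrow> 'v complexified \<Rightarrow> 'v complexified" where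
  "cmap J z = (J (fst z), J (snd z))"

text \<open>Complex-linear extension of a linear form, and argument by argument of multilinear forms.\<close>

definition cext1 :: "('v::real_vector \<Rightarrow> complex) \<Rightarrow> 'v complexified \<Rightarrow> complex" where
  "cext1 f z = f (fst z) + \<i> * f (snd z)"

definition cext2 ::
    "('v::real_vector \<Rightarrow> 'v \<Rightarrow> real) \<Rightarrow> 'v complexified \<Rightarrow> 'v complexified \<Rightarrow> complex" where
  "cext2 b x y = cext1 (\<lambda>x'. cext1 (\<lambda>y'. complex_of_real (b x' y')) y) x"

definition cext4 ::
    "('v::real_vector \<Rightarrow> 'v \<Rightarrow> 'v \<Rightarrow> 'v \<Rightarrow> real) \<Rightarrow>
     'v complexified \<Rightarrow> 'v complexified \<Rightarrow> 'v complexified \<Rightarrow> 'v complexified \<Rightarrow> complex" where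
  "cext4 K x y z w =
     cext1 (\<lambda>x'. cext1 (\<lambda>y'. cext1 (\<lambda>z'. cext1 (\<lambda>w'. complex_of_real (K x' y' z' w')) w) z) y) x"

definition W_space :: "('v::euclidean_space \<Rightarrow>\<^sub>L 'v) \<Rightarrow> 'v complexified set" where
  "W_space J1 = {z. cmap J1 z = \<i> *\<^sub>C z}"

text \<open>
  The 2-form determined by \<open>x \<bullet> y = \<pi>(x, J2 y)\<close>; since \<open>J2\<close> squares to minus the identity, it is
  \<open>\<pi>(x, y) = - x \<bullet> J2 y\<close> (see \<open>pi_form_unique\<close>). It is used through its complex-bilinear extension.
\<close>

definition pi_form :: "('v::euclidean_space \<Rightarrow>\<^sub>L 'v) \<Rightarrow> 'v \<Rightarrow> 'v \<Rightarrow> real" where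
  "pi_form J2 x y = - (x \<bullet> J2 y)"

text \<open>
  Bases of \<open>W\<close> are indexed by \<open>{1..4}\<close>. In the last conjunct \<open>x \<alpha>\<close>, \<open>y \<alpha>\<close> are the values of the
  dual basis element \<open>e\<^sup>\<alpha>\<close>, with the convention \<open>(\<xi> \<and> \<eta>)(x, y) = \<xi>(x) \<eta>(y) - \<xi>(y) \<eta>(x)\<close>.
\<close>

definition sp2_adapted ::
    "('v::euclidean_space \<Rightarrow>\<^sub>L 'v) \<Rightarrow> ('v \<Rightarrow>\<^sub>L 'v) \<Rightarrow> (nat \<Rightarrow> 'v complexified) \<Rightarrow> bool" where
  "sp2_adapted J1 J2 e \<longleftrightarrow>
     inj_on e {1..4} \<and> cV.independent (e ` {1..4}) \<and> cV.span (e ` {1..4}) = W_space J1 \<and>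
     e 3 = cmap J2 (cconj (e 1)) \<and> e 4 = cmap J2 (cconj (e 2)) \<and>
     (\<forall>x y :: nat \<Rightarrow> complex.
        cext2 (pi_form J2) (\<Sum>\<alpha>=1..4. x \<alpha> *\<^sub>C e \<alpha>) (\<Sum>\<alpha>=1..4. y \<alpha> *\<^sub>C e \<alpha>) =
        (x 1 * y 3 - y 1 * x 3) + (x 2 * y 4 - y 2 * x 4))"

definition S_tensor ::
    "('v::euclidean_space \<Rightarrow>\<^sub>L 'v) \<Rightarrow> ('v \<Rightarrow>\<^sub>L 'v) \<Rightarrow> ('v \<Rightarrow> 'v \<Rightarrow> 'v \<Rightarrow> 'v \<Rightarrow> real) \<Rightarrow>
     'v \<Rightarrow> 'v \<Rightarrow> 'v \<Rightarrow> 'v \<Rightarrow> real" where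
  "S_tensor J2 J3 K x y z w = 1/2 * (K x (J2 y) z (J2 w) - K x (J3 y) z (J3 w))"

definition discr_curv ::
    "('v::euclidean_space \<Rightarrow>\<^sub>L 'v) \<Rightarrow> ('v \<Rightarrow>\<^sub>L 'v) \<Rightarrow> ('v \<Rightarrow>\<^sub>L 'v) \<Rightarrow>
     ('v \<Rightarrow> 'v \<Rightarrow> 'v \<Rightarrow> 'v \<Rightarrow> real) set" where
  "discr_curv J1 J2 J3 =
     {K \<in> curv_sp2 J1 J2 J3. \<exists>e. sp2_adapted J1 J2 e \<and>
        (\<forall>x :: nat \<Rightarrow> complex.
           let X = (\<Sum>\<alpha>=1..4. x \<alpha> *\<^sub>C e \<alpha>) in
           cext4 (S_tensor J2 J3 K) X X X X =
             - 18 * x 1 * x 2 * x 3 * x 4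
             + 4 * complex_of_real (sqrt 3) * x 1 * (x 4)^3
             - 4 * complex_of_real (sqrt 3) * (x 2)^3 * x 3
             + 3 * (x 2)^2 * (x 4)^2
             - 9 * (x 1)^2 * (x 3)^2)}"

lemma pi_form_unique:
  assumes "J2 o\<^sub>L J2 = - id_blinfun" and "linear (\<lambda>y. p x y)"
  shows "(\<forall>y. x \<bullet> y = p x (J2 y)) \<longleftrightarrow> (\<forall>y. p x y = pi_form J2 x y)"
proof -
  have J: "J2 (J2 y) = - y" for y
    using arg_cong[OF assms(1), of "\<lambda>f. blinfun_apply f y"]
    by (simp add: blinfun.bilinear_simps)
  show ?thesis
  proof (intro iffI allI)
    fix y assume *: "\<forall>y. x \<bullet> y = p x (J2 y)"
    have "x \<bullet> J2 y = p x (- y)" using * J by metis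
    then show "p x y = pi_form J2 x y"
      using linear_neg[OF assms(2)] by (simp add: pi_form_def)
  qed (simp add: pi_form_def J)
qed

lemma curv_op_inner:
  fixes H :: "'v::euclidean_space set"
  assumes K: "K \<in> curv_sp2 J1 J2 J3"
    and H: "pairwise orthogonal H" "\<forall>h\<in>H. norm h = 1" "span H = UNIV"
  shows "curv_op K A x \<bullet> y = 1/2 * (\<Sum>h\<in>H. K x y h (A h))"
proof -
  have lin_all: "(\<forall>y z w. linear (\<lambda>x. K x y z w)) \<and> (\<forall>x z w. linear (\<lambda>y. K x y z w)) \<and>
      (\<forall>x y w. linear (\<lambda>z. K x y z w)) \<and> (\<forall>x y z. linear (\<lambda>w. K x y z w))"
    using K unfolding curv_sp2_def mem_Collect_eq by - (elim conjE, intro conjI; assumption)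
  have l1: "linear (\<lambda>x. K x y z w)" for y z w
    by (rule lin_all[THEN conjunct1, rule_format])
  have l2: "linear (\<lambda>y. K x y z w)" for x z w
    by (rule lin_all[THEN conjunct2, THEN conjunct1, rule_format])
  have l3: "linear (\<lambda>z. K x y z w)" for x y w
    by (rule lin_all[THEN conjunct2, THEN conjunct2, THEN conjunct1, rule_format])
  have l4: "linear (\<lambda>w. K x y z w)" for x y z
    by (rule lin_all[THEN conjunct2, THEN conjunct2, THEN conjunct2, rule_format])
  have "0 \<notin> H" using H by auto
  then have ind: "independent H" using H pairwise_orthogonal_independent by blast
  then have fin: "finite H" by (rule finiteI_independent)
  have exp_H: "v = (\<Sum>h\<in>H. (v \<bullet> h) *\<^sub>R h)" for v
  proof -
    have "v \<in> span H" using H by simp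
    then have "(\<Sum>h\<in>H. (v \<bullet> h) *\<^sub>R h) = v"
      by (intro orthonormal_basis_expand) (use H fin in auto)
    then show ?thesis by simp
  qed
  have parseval: "(\<Sum>h\<in>H. (v \<bullet> h) * (w \<bullet> h)) = v \<bullet> w" for v w
  proof -
    have "v \<bullet> w = v \<bullet> (\<Sum>h\<in>H. (w \<bullet> h) *\<^sub>R h)" using exp_H[of w] by simp
    then show ?thesis by (simp add: inner_sum_right mult.commute)
  qed
  have lin: "f v = (\<Sum>b\<in>Basis. (v \<bullet> b) * f b)" if "linear f" for f :: "'v \<Rightarrow> real" and v
  proof -
    have "f v = f (\<Sum>b\<in>Basis. (v \<bullet> b) *\<^sub>R b)" by (simp only: euclidean_representation)
    then show ?thesis by (simp only: linear_sum[OF that] linear_cmul[OF that] real_scaleR_def)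
  qed
  have linA: "linear (\<lambda>u. K x y z (A u))" for x y z
    by (rule linearI)
      (simp_all only: blinfun.add_right blinfun.scaleR_right linear_add[OF l4] linear_cmul[OF l4])
  have indep: "(\<Sum>h\<in>H. K x y h (A h)) = (\<Sum>b\<in>Basis. K x y b (A b))" for x y
  proof -
    have e: "K x y h (A h) = (\<Sum>b\<in>Basis. \<Sum>c\<in>Basis. (b \<bullet> h) * (c \<bullet> h) * K x y b (A c))" for h
    proof -
      have "K x y h (A h) = (\<Sum>b\<in>Basis. (h \<bullet> b) * K x y b (A h))"
        by (rule lin[OF l3])
      also have "\<dots> = (\<Sum>b\<in>Basis. (h \<bullet> b) * (\<Sum>c\<in>Basis. (h \<bullet> c) * K x y b (A c)))"
        using lin[OF linA] by (intro sum.cong arg_cong2[where f = "(*)"] refl)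
      finally show ?thesis by (simp add: sum_distrib_left inner_commute mult.assoc)
    qed
    have "(\<Sum>h\<in>H. K x y h (A h)) =
        (\<Sum>b\<in>Basis. \<Sum>h\<in>H. \<Sum>c\<in>Basis. (b \<bullet> h) * (c \<bullet> h) * K x y b (A c))"
      unfolding e by (rule sum.swap)
    also have "\<dots> = (\<Sum>b\<in>Basis. \<Sum>c\<in>Basis. \<Sum>h\<in>H. (b \<bullet> h) * (c \<bullet> h) * K x y b (A c))"
      by (rule sum.cong[OF refl]) (rule sum.swap)
    also have "\<dots> = (\<Sum>b\<in>Basis. \<Sum>c\<in>Basis. (b \<bullet> c) * K x y b (A c))"
      by (simp only: sum_distrib_right[symmetric] parseval)
    also have "\<dots> = (\<Sum>b\<in>Basis. \<Sum>c\<in>Basis. (if b = c then K x y b (A c) else 0))"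
      by (intro sum.cong refl) (auto simp: inner_Basis)
    finally show ?thesis by simp
  qed
  define F where "F x = (\<Sum>c\<in>Basis. (1/2 * (\<Sum>b\<in>Basis. K x c b (A b))) *\<^sub>R c)" for x
  have "linear F"
  proof (rule linearI)
    fix u v
    show "F (u + v) = F u + F v"
      by (simp only: F_def linear_add[OF l1] sum.distrib distrib_left scaleR_add_left)
  next
    fix r u
    show "F (r *\<^sub>R u) = r *\<^sub>R F u"
      by (simp only: F_def linear_cmul[OF l1] real_scaleR_def sum_distrib_left[symmetric]
          scaleR_sum_right scaleR_scaleR mult.left_commute)
  qed
  then have bl: "bounded_linear F" by (simp add: linear_conv_bounded_linear)
  have FB: "F x \<bullet> y = 1/2 * (\<Sum>b\<in>Basis. K x y b (A b))" for x y
  proof -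
    have "(\<Sum>b\<in>Basis. K x y b (A b)) = (\<Sum>b\<in>Basis. \<Sum>c\<in>Basis. (y \<bullet> c) * K x c b (A b))"
      by (intro sum.cong refl lin[OF l2])
    also have "\<dots> = (\<Sum>c\<in>Basis. (y \<bullet> c) * (\<Sum>b\<in>Basis. K x c b (A b)))"
      by (subst sum.swap) (simp only: sum_distrib_left)
    finally have "(\<Sum>b\<in>Basis. K x y b (A b)) = \<dots>" .
    moreover have "F x \<bullet> y = (\<Sum>c\<in>Basis. 1/2 * ((y \<bullet> c) * (\<Sum>b\<in>Basis. K x c b (A b))))"
      unfolding F_def inner_sum_left inner_scaleR_left
      by (intro sum.cong refl) (simp only: inner_commute mult.assoc mult.commute)
    ultimately show ?thesis by (simp only: sum_distrib_left[symmetric])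
  qed
  have "\<forall>x y. curv_op K A x \<bullet> y = 1/2 * (\<Sum>b\<in>Basis. K x y b (A b))"
    unfolding curv_op_def
  proof (rule theI[where a = "Blinfun F"])
    show "\<forall>x y. blinfun_apply (Blinfun F) x \<bullet> y = 1/2 * (\<Sum>b\<in>Basis. K x y b (A b))"
      by (simp add: bounded_linear_Blinfun_apply[OF bl] FB)
    fix T :: "'v \<Rightarrow>\<^sub>L 'v"
    assume "\<forall>x y. T x \<bullet> y = 1/2 * (\<Sum>b\<in>Basis. K x y b (A b))"
    then have "T x \<bullet> y = F x \<bullet> y" for x y by (simp add: FB)
    then have "T x = F x" for x by (meson vector_eq_rdot)
    then show "T = Blinfun F"
      by (intro blinfun_eqI) (simp add: bounded_linear_Blinfun_apply[OF bl])
  qed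
  then show ?thesis by (simp add: indep)
qed

lemma curv_op_in_sp2:
  fixes J1 J2 J3 :: "'v::euclidean_space \<Rightarrow>\<^sub>L 'v"
  assumes "hyper_hermitian J1 J2 J3" and K: "K \<in> curv_sp2 J1 J2 J3"
  shows "curv_op K A \<in> sp2 J1 J2 J3"
proof -
  have s1: "K y x z w = - K x y z w" and s2: "K x y w z = - K x y z w"
    and bi: "K x y z w + K y z x w + K z x y w = 0" for x y z w
    using K unfolding curv_sp2_def by blast+
  have pair: "K x y z w = K z w x y" for x y z w
    using bi[of x y z w] bi[of y z w x] bi[of z w x y] bi[of w x y z]
      s1[of x y z w] s1[of y z w x] s1[of z w x y] s1[of w x y z] s1[of x z y w] s1[of y w z x]
      s2[of x y w z] s2[of y z x w] s2[of z w x y] s2[of w x y z] s2[of x z y w] s2[of y w z x]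
      s2[of z x y w] s2[of w y z x] s1[of w y z x] s1[of z x y w] s1[of w y x z] s2[of w y x z]
      s2[of x z w y] s1[of x z w y] s2[of x y z w]
    by linarith
  have T: "curv_op K A x \<bullet> y = 1/2 * (\<Sum>h\<in>Basis. K x y h (A h))" for x y
    by (rule curv_op_inner[OF K])
      (auto simp: pairwise_def orthogonal_def inner_Basis span_Basis)
  have skew: "curv_op K A x \<bullet> y + x \<bullet> curv_op K A y = 0" for x y
    using T[of x y] T[of y x] by (simp add: s1[of y x] inner_commute sum_negf)
  have "curv_op K A o\<^sub>L J = J o\<^sub>L curv_op K A" if J: "J \<in> {J1, J2, J3}" for J
  proof (rule blinfun_eqI)
    fix x
    have sq: "J o\<^sub>L J = - id_blinfun" and orth: "J u \<bullet> J v = u \<bullet> v" for u v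
      using assms(1) J unfolding hyper_hermitian_def by blast+
    have JJ: "J (J v) = - v" for v
      using arg_cong[OF sq, of "\<lambda>f. blinfun_apply f v"] by (simp add: blinfun.minus_left)
    have inv: "K (J u) (J v) z w = K u v z w" for u v z w
    proof -
      have "K z w (J u) (J v) = K z w u v" using K J unfolding curv_sp2_def by blast
      then show ?thesis using pair by metis
    qed
    have "curv_op K A (J x) \<bullet> y = J (curv_op K A x) \<bullet> y" for y
    proof -
      have "curv_op K A (J x) \<bullet> J (J y) = curv_op K A x \<bullet> J y"
        by (simp only: T inv)
      moreover have "J (curv_op K A x) \<bullet> J (J y) = curv_op K A x \<bullet> J y"
        by (rule orth)
      ultimately show ?thesis by (simp add: JJ)
    qed
    then show "(curv_op K A o\<^sub>L J) x = (J o\<^sub>L curv_op K A) x"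
      unfolding blinfun_apply_blinfun_compose by (meson vector_eq_rdot)
  qed
  then show ?thesis using skew by (auto simp: sp2_def)
qed

end

theory Submission
  imports Defs
begin

text \<open>
  The operator \<open>\<T>\<^sub>K\<close> is symmetric for the Frobenius inner product, so put \<open>P = (2 \<T>\<^sub>K + 3) / 10\<close>.
  Condition (I) says that \<open>P\<close> is an orthogonal projection of \<open>sp(2)\<close> onto a subspace \<open>h\<close>, and (II)
  turns into \<open>[P A, P B] = P [P A, B]\<close>, i.e. \<open>h\<close> is a subalgebra. With an orthonormal basis \<open>A\<^sub>i\<close>
  of \<open>h\<close> the tensor is recovered as \<open>10 \<Sum> A\<^sub>i \<otimes> A\<^sub>i\<close> minus a multiple of the identity of \<open>sp(2)\<close>,
  and the quartic form on \<open>W\<close> is \<open>10 \<Sum> q\<^sub>i\<^sup>2\<close> for the quadratic forms \<open>q\<^sub>i\<close> of the \<open>A\<^sub>i\<close>.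

  The Bianchi identity forces \<open>h\<close> to have dimension 3. Diagonalise one \<open>H \<in> h\<close> with weights
  \<open>l \<ge> m \<ge> 0\<close> on \<open>W\<close>: its eigenvectors in \<open>h\<close> are combinations of roots, and among all possibilities
  the Bianchi identity only admits \<open>l = 3 m\<close>, the principal \<open>su(2)\<close>, for which \<open>W\<close> is the space of
  binary cubics. The sum of squares is then the discriminant, after adjusting one phase of the basis.
  Conversely, the quartic form determines the tensor by polarization, so that a discriminant tensor
  is the one built from the principal \<open>su(2)\<close>, whose operator visibly satisfies (I) and (II).
\<close>

section \<open>Linear algebra of skew operators: trace form, brackets, polarization, extremal
  eigenvectors\<close>

definition wedge_op :: "'v::euclidean_space \<Rightarrow> 'v \<Rightarrow> 'v \<Rightarrow>\<^sub>L 'v" where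
  "wedge_op z w =
     (blinfun_scaleR_left w o\<^sub>L blinfun_inner_left z) - (blinfun_scaleR_left z o\<^sub>L blinfun_inner_left w)"

lemma wedge_op_apply: "wedge_op z w x = (z \<bullet> x) *\<^sub>R w - (w \<bullet> x) *\<^sub>R z"
  by (simp add: wedge_op_def blinfun.diff_left inner_commute)

text \<open>The trace of the transpose of \<open>A\<close> times \<open>B\<close>. For skew
  \<open>A\<close> it is minus the trace of \<open>A B\<close>, so it is an ad-invariant inner
  product on sp(2).\<close>

definition frob :: "('v::euclidean_space \<Rightarrow>\<^sub>L 'v) \<Rightarrow> ('v \<Rightarrow>\<^sub>L 'v) \<Rightarrow> real" where
  "frob A B = (\<Sum>h\<in>Basis. A h \<bullet> B h)"

lemma frob_commute: "frob A B = frob B A"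
  by (simp add: frob_def inner_commute)

lemma frob_bilinear:
  "frob (A + B) C = frob A C + frob B C" "frob (A - B) C = frob A C - frob B C"
  "frob (r *\<^sub>R A) C = r * frob A C" "frob (- A) C = - frob A C"
  "frob C (A + B) = frob C A + frob C B" "frob C (A - B) = frob C A - frob C B"
  "frob C (r *\<^sub>R A) = r * frob C A" "frob C (- A) = - frob C A"
  "frob 0 C = 0" "frob C 0 = 0"
  by (simp_all add: frob_def blinfun.bilinear_simps algebra_simps sum.distrib sum_subtractf sum_negf
      sum_distrib_left)

lemma inner_Basis_expand: "(\<Sum>h\<in>Basis. (h \<bullet> x) * f h) = f x" 
  if "linear f" for f :: "'v::euclidean_space \<Rightarrow> real"
proof -
  have "f x = f (\<Sum>b\<in>Basis. (x \<bullet> b) *\<^sub>R b)" by (simp only: euclidean_representation)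
  then show ?thesis
    by (simp add: linear_sum[OF that] linear_cmul[OF that] inner_commute)
qed

lemma inner_Basis_apply: "(\<Sum>h\<in>Basis. (h \<bullet> x) * (blinfun_apply A h \<bullet> w)) = A x \<bullet> w"
  for x w :: "'v::euclidean_space"
  by (rule inner_Basis_expand)
    (auto intro!: linearI simp: blinfun.bilinear_simps inner_left_distrib)

lemma bracket_apply: "bracket A B x = A (B x) - B (A x)"
  by (simp add: bracket_def blinfun.bilinear_simps)

lemma bracket_bilinear:
  "bracket (A + B) C = bracket A C + bracket B C" "bracket C (A + B) = bracket C A + bracket C B"
  "bracket (A - B) C = bracket A C - bracket B C" "bracket C (A - B) = bracket C A - bracket C B"
  "bracket (r *\<^sub>R A) C = r *\<^sub>R bracket A C" "bracket C (r *\<^sub>R A) = r *\<^sub>R bracket C A"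
  "bracket A A = 0" "bracket 0 A = 0" "bracket A 0 = 0"
  by (rule blinfun_eqI, simp add: bracket_apply blinfun.bilinear_simps scaleR_diff_right)+

lemma bracket_commute: "bracket A B = - bracket B A"
  by (simp add: bracket_def)

text \<open>Cyclicity of the trace for a skew factor: expanding in the basis and exchanging the two
  sums moves \<open>X\<close> from one side of \<open>M\<close> to the other.\<close>

lemma sum_inner_skew:
  fixes X M :: "'v::euclidean_space \<Rightarrow>\<^sub>L 'v"
  assumes "\<And>x y. X x \<bullet> y = - (x \<bullet> X y)"
  shows "(\<Sum>h\<in>Basis. X h \<bullet> M h) = - (\<Sum>h\<in>Basis. M (X h) \<bullet> h)"
proof -
  have "(\<Sum>h\<in>Basis. X h \<bullet> M h) = (\<Sum>h\<in>Basis. \<Sum>k\<in>Basis. (X h \<bullet> k) * (M h \<bullet> k))"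
    by (intro sum.cong refl) (rule euclidean_inner)
  also have "\<dots> = (\<Sum>k\<in>Basis. \<Sum>h\<in>Basis. (X h \<bullet> k) * (M h \<bullet> k))"
    by (rule sum.swap)
  also have "\<dots> = (\<Sum>k\<in>Basis. - (M (X k) \<bullet> k))"
  proof (rule sum.cong[OF refl])
    fix k :: 'v
    have "(\<Sum>h\<in>Basis. (X h \<bullet> k) * (M h \<bullet> k)) = - (\<Sum>h\<in>Basis. (h \<bullet> X k) * (M h \<bullet> k))"
      by (simp add: assms[of _ k] sum_negf)
    then show "(\<Sum>h\<in>Basis. (X h \<bullet> k) * (M h \<bullet> k)) = - (M (X k) \<bullet> k)"
      by (simp add: inner_Basis_apply)
  qed
  finally show ?thesis by (simp add: sum_negf)
qed

text \<open>Invariance of the trace form under \<open>ad X\<close>. Skewness moves the outer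
  \<open>X\<close> across in the terms \<open>X Y\<close> and \<open>X Z\<close>; the terms
  \<open>Y X\<close> and \<open>Z X\<close> are matched by cyclicity.\<close>

lemma frob_bracket:
  fixes X Y Z :: "'v::euclidean_space \<Rightarrow>\<^sub>L 'v"
  assumes X: "\<And>x y. X x \<bullet> y = - (x \<bullet> X y)" and Y: "\<And>x y. Y x \<bullet> y = - (x \<bullet> Y y)"
  shows "frob (bracket X Y) Z = - frob Y (bracket X Z)"
proof -
  have "(\<Sum>h\<in>Basis. Y (X h) \<bullet> Z h) = - (\<Sum>h\<in>Basis. X h \<bullet> (Y o\<^sub>L Z) h)"
    by (simp add: Y sum_negf)
  also have "\<dots> = (\<Sum>h\<in>Basis. Y (Z (X h)) \<bullet> h)"
    by (subst sum_inner_skew[OF X]) simp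
  also have "\<dots> = - (\<Sum>h\<in>Basis. Y h \<bullet> Z (X h))"
    unfolding sum_negf[symmetric]
    by (intro sum.cong refl) (metis Y inner_commute)
  finally have "(\<Sum>h\<in>Basis. Y (X h) \<bullet> Z h) = - (\<Sum>h\<in>Basis. Y h \<bullet> Z (X h))" .
  then show ?thesis
    by (simp add: frob_def bracket_apply inner_diff X sum_subtractf sum_negf)
qed

text \<open>Adding the diagonal values at \<open>x + y\<close> and \<open>x - y\<close> cancels the
  odd terms and leaves \<open>12 * f x x y y\<close>; polarizing the first pair and then the last
  pair of arguments yields every value. Additivity suffices, since the argument only divides by
  integers.\<close>

lemma quadrilinear_polarization:
  fixes f :: "'a::ab_group_add \<Rightarrow> 'a \<Rightarrow> 'a \<Rightarrow> 'a \<Rightarrow> complex"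
  assumes add: "\<And>x x' y z w. f (x + x') y z w = f x y z w + f x' y z w"
    and s12: "\<And>x y z w. f y x z w = f x y z w"
    and s23: "\<And>x y z w. f x z y w = f x y z w"
    and s34: "\<And>x y z w. f x y w z = f x y z w"
    and diag: "\<And>x. f x x x x = 0"
  shows "f x y z w = 0"
proof -
  have add2: "f y (x + x') z w = f y x z w + f y x' z w" for x x' y z w
    using add[of x x' y z w] by (simp only: s12)
  have add3: "f y z (x + x') w = f y z x w + f y z x' w" for x x' y z w
    using add2[of y x x' z w] by (simp only: s23)
  have add4: "f y z w (x + x') = f y z w x + f y z w x'" for x x' y z w
    using add3[of y z x x' w] by (simp only: s34)
  note adds = add add2 add3 add4
  have m1: "f (- x) y z w = - f x y z w" for x y z w
    using add[of "-x" x y z w] add[of 0 0 y z w] by (simp add: eq_neg_iff_add_eq_0 add.commute)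
  have m2: "f y (- x) z w = - f y x z w" for x y z w
    using m1[of x y z w] by (simp only: s12)
  have m3: "f y z (- x) w = - f y z x w" for x y z w
    using m2[of y x z w] by (simp only: s23)
  have m4: "f y z w (- x) = - f y z w x" for x y z w
    using m3[of y z x w] by (simp only: s34)
  have e: "f x x y y = 0" for x y
  proof -
    have r: "f x y x y = f x x y y" "f x y y x = f x x y y" "f y x x y = f x x y y"
      "f y x y x = f x x y y" "f y y x x = f x x y y"
      by (metis s12 s23 s34)+
    have "f (x + y) (x + y) (x + y) (x + y) + f (x + - y) (x + - y) (x + - y) (x + - y) =
        2 * f x x x x + 12 * f x x y y + 2 * f y y y y"
      unfolding adds m1 m2 m3 m4 by (simp add: r)
    then show ?thesis unfolding diag by simp
  qed
  have double: "a + b = 0 \<Longrightarrow> b = a \<Longrightarrow> a = 0" for a b :: complex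
    by simp
  have e': "f x z y y = 0" for x y z
  proof (rule double[OF _ s12])
    have "f (x + z) (x + z) y y = f x x y y + (f x z y y + f z x y y) + f z z y y"
      by (simp add: add add2)
    then show "f x z y y + f z x y y = 0" by (simp add: e)
  qed
  show ?thesis
  proof (rule double[OF _ s34])
    have "f x y (z + w) (z + w) = f x y z z + (f x y z w + f x y w z) + f x y w w"
      by (simp add: add3 add4)
    then show "f x y z w + f x y w z = 0" by (simp add: e')
  qed
qed

text \<open>First-order condition at a maximum, used in \<open>skew_max_eigenvector\<close>.\<close>

lemma linear_coeff_eq_0:
  fixes a b :: real
  assumes "\<And>t. 2 * t * a + t\<^sup>2 * b \<le> 0"
  shows "a = 0"
proof (rule ccontr)
  assume a: "a \<noteq> 0"
  \<comment> \<open>At \<open>t = a / D\<close> the quadratic equals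
    \<open>a^2 / D * (2 + b / D)\<close>. This \<open>D\<close> makes \<open>b / D\<close> at least
    -1, so the value is positive.\<close>
  define D where "D = 1 + \<bar>b\<bar>"
  let ?t = "a / D"
  have "- 1 \<le> b / D" "0 < D" by (simp_all add: D_def field_simps)
  then have "0 < a\<^sup>2 / D * (2 + b / D)"
    using a by (intro mult_pos_pos) auto
  also have "\<dots> = 2 * ?t * a + ?t\<^sup>2 * b"
    by (simp add: divide_inverse power2_eq_square algebra_simps)
  finally have "0 < 2 * ?t * a + ?t\<^sup>2 * b" .
  with assms[of ?t] show False by simp
qed

text \<open>A point \<open>w\<close> of the unit sphere where \<open>H x \<bullet> H x\<close> is
  maximal is critical, which makes it an eigenvector of \<open>H\<close> squared. The bound for all
  \<open>x\<close> later orders the two weights.\<close>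

lemma skew_max_eigenvector:
  fixes H :: "'v::euclidean_space \<Rightarrow>\<^sub>L 'v"
  assumes sk: "\<And>x y. H x \<bullet> y = - (x \<bullet> H y)"
  obtains w M where "w \<bullet> w = 1" "0 \<le> M" "H (H w) = - M *\<^sub>R w" "\<And>x. H x \<bullet> H x \<le> M * (x \<bullet> x)"
proof -
  obtain b :: 'v where "b \<in> Basis" by fastforce
  then have "sphere 0 1 \<noteq> ({} :: 'v set)" by (auto intro!: exI[of _ b])
  moreover have "continuous_on (sphere 0 1) (\<lambda>x. H x \<bullet> H x)"
    by (intro continuous_intros)
  ultimately obtain w where w: "w \<in> sphere 0 1"
    and max: "\<And>x. x \<in> sphere 0 1 \<Longrightarrow> H x \<bullet> H x \<le> H w \<bullet> H w"
    using continuous_attains_sup[of "sphere (0::'v) 1" "\<lambda>x. H x \<bullet> H x"] by auto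
  define M where "M = H w \<bullet> H w"
  have ww: "w \<bullet> w = 1" using w by (simp add: dot_square_norm)
  have le: "H x \<bullet> H x \<le> M * (x \<bullet> x)" for x
  proof (cases "x = 0")
    case False
    have "H ((1 / norm x) *\<^sub>R x) \<bullet> H ((1 / norm x) *\<^sub>R x) \<le> M"
      unfolding M_def using False by (intro max) simp
    then have "(H x \<bullet> H x) / (norm x)\<^sup>2 \<le> M"
      by (simp add: blinfun.scaleR_right power2_eq_square)
    then show ?thesis using False by (simp add: field_simps dot_square_norm)
  qed (simp add: blinfun.zero_right)
  have "H w \<bullet> H x - M * (w \<bullet> x) = 0" for x
  proof (rule linear_coeff_eq_0)
    fix t
    show "2 * t * (H w \<bullet> H x - M * (w \<bullet> x)) + t\<^sup>2 * (H x \<bullet> H x - M * (x \<bullet> x)) \<le> 0"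
      using le[of "w + t *\<^sub>R x"]
      by (simp add: blinfun.bilinear_simps inner_left_distrib inner_right_distrib M_def[symmetric] ww
          power2_eq_square algebra_simps inner_commute[of x w] inner_commute[of "H x" "H w"])
  qed
  then have "- (H (H w)) \<bullet> x = (M *\<^sub>R w) \<bullet> x" for x
    by (simp add: sk[of "H w" x])
  then have "- (H (H w)) = M *\<^sub>R w"
    by (meson vector_eq_rdot)
  then have "H (H w) = - M *\<^sub>R w" by (simp add: minus_equation_iff[of "H (H w)"])
  then show ?thesis
    using that[OF ww _ _ le] by (simp add: M_def)
qed

lemma sum_1_4: "(\<Sum>\<alpha>=1..4. f \<alpha>) = f 1 + f 2 + f 3 + f (4::nat)"
  for f :: "nat \<Rightarrow> 'a::comm_monoid_add"
  by (simp add: eval_nat_numeral add.assoc)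

text \<open>
  The variables in the next two lemmas are the coordinates (see \<open>bracket_diagonal\<close>) of two
  elements spanning the complement of \<open>H\<close> in \<open>h\<close>, on which \<open>ad H\<close> is a rotation with speed \<open>\<nu>\<close>.
  The possible values of \<open>\<bar>\<nu>\<bar>\<close> are the roots \<open>2l\<close> (coordinates \<open>p\<close>), \<open>2m\<close> (\<open>r\<close>), \<open>l - m\<close> (\<open>q\<^sub>0, q\<^sub>1\<close>)
  and \<open>l + m\<close> (\<open>q\<^sub>2, q\<^sub>3\<close>); the case \<open>\<nu> = 0\<close> would make \<open>h\<close> abelian.
\<close>

lemma root_analysis:
  fixes l m \<nu> :: real
  assumes lm: "0 \<le> m" "m \<le> l" and \<nu>: "\<nu> \<noteq> 0"
    and P: "l\<^sup>2 + (p2\<^sup>2 + p3\<^sup>2) + (p2'\<^sup>2 + p3'\<^sup>2) = 9/40"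
    and R: "m\<^sup>2 + (r2\<^sup>2 + r3\<^sup>2) + (r2'\<^sup>2 + r3'\<^sup>2) = 9/40"
    and Q: "(q0\<^sup>2 + q1\<^sup>2) + (q0'\<^sup>2 + q1'\<^sup>2) - l * m = 3/40"
    and Q': "(q2\<^sup>2 + q3\<^sup>2) + (q2'\<^sup>2 + q3'\<^sup>2) + l * m = 3/40"
    and p: "2 * l * p3 = \<nu> * p2'" "- 2 * l * p2 = \<nu> * p3'" "2 * l * p3' = - \<nu> * p2" "- 2 * l * p2' = - \<nu> * p3"
    and r: "2 * m * r3 = \<nu> * r2'" "- 2 * m * r2 = \<nu> * r3'" "2 * m * r3' = - \<nu> * r2" "- 2 * m * r2' = - \<nu> * r3"
    and q: "(l - m) * q1 = \<nu> * q0'" "- (l - m) * q0 = \<nu> * q1'" "(l - m) * q1' = - \<nu> * q0" "- (l - m) * q0' = - \<nu> * q1"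
    and q': "(l + m) * q3 = \<nu> * q2'" "- (l + m) * q2 = \<nu> * q3'" "(l + m) * q3' = - \<nu> * q2" "- (l + m) * q2' = - \<nu> * q3"
  obtains s where "s * s = 1" "l = 3 * m" "m\<^sup>2 = 1/40" "p2 = 0" "p3 = 0" "p2' = 0" "p3' = 0"
    "q2 = 0" "q3 = 0" "q2' = 0" "q3' = 0" "r2' = s * r3" "r3' = - s * r2" "q0' = s * q1" "q1' = - s * q0"
    "r2\<^sup>2 + r3\<^sup>2 = 1/10" "q0\<^sup>2 + q1\<^sup>2 = 3/40"
proof -
  \<comment> \<open>Applying the rotation twice multiplies each coordinate both by
    \<open>k^2\<close> and by \<open>\<nu>^2\<close>, so a root plane of speed \<open>k\<close>
    carries nothing unless these agree.\<close>
  have root: "a = 0 \<and> b = 0 \<and> a' = 0 \<and> b' = 0"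
    if "k * b = \<nu> * a'" "- k * a = \<nu> * b'" "k * b' = - \<nu> * a" "- k * a' = - \<nu> * b" "k\<^sup>2 \<noteq> \<nu>\<^sup>2"
    for k a b a' b' :: real
  proof -
    have "(k\<^sup>2 - \<nu>\<^sup>2) * a = 0" "(k\<^sup>2 - \<nu>\<^sup>2) * b = 0" "(k\<^sup>2 - \<nu>\<^sup>2) * a' = 0" "(k\<^sup>2 - \<nu>\<^sup>2) * b' = 0"
      using that(1-4) by algebra+
    then show ?thesis using that(5) by simp
  qed
  \<comment> \<open>By \<open>Q\<close> the squares of the \<open>q0\<close>, \<open>q1\<close>
    coordinates add up to at least 3/40, so they do not all vanish and \<open>\<nu>\<close> is
    \<open>l - m\<close> up to sign.\<close>
  have "0 \<le> l * m" using lm by simp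
  then have "\<not> (q0 = 0 \<and> q1 = 0 \<and> q0' = 0 \<and> q1' = 0)"
    using Q by auto
  then have \<nu>2: "\<nu>\<^sup>2 = (l - m)\<^sup>2"
    using root[OF q] by metis
  \<comment> \<open>With \<open>m = 0\<close> the root \<open>2 * m\<close> would be zero, forcing
    the \<open>r\<close>-coordinates to vanish, against \<open>R\<close>.\<close>
  have m: "m \<noteq> 0"
  proof
    assume m0: "m = 0"
    then have "(2 * m)\<^sup>2 \<noteq> \<nu>\<^sup>2" using \<nu> by simp
    then show False using root[of "2 * m", OF r(1) _ r(3)] r(2,4) R m0 by simp
  qed
  then have pos: "0 < m" "0 < l" using lm by simp_all
  \<comment> \<open>Since \<open>0 < m \<le> l\<close>, the root \<open>l - m\<close> matches
    neither \<open>2 * l\<close> nor \<open>l + m\<close>. Hence the \<open>p\<close>-coordinates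
    and \<open>q2\<close>, \<open>q3\<close> vanish, and \<open>P\<close> and \<open>Q'\<close>
    reduce to conditions on \<open>l\<close> and \<open>m\<close> alone.\<close>
  have lt: "(l - m)\<^sup>2 < l\<^sup>2"
    using pos lm by (intro power_strict_mono) simp_all
  moreover have "(2 * l)\<^sup>2 = 4 * l\<^sup>2" by (simp add: power_mult_distrib)
  ultimately have "(2 * l)\<^sup>2 \<noteq> \<nu>\<^sup>2" unfolding \<nu>2 using zero_le_power2[of l] by linarith
  then have p0: "p2 = 0" "p3 = 0" "p2' = 0" "p3' = 0"
    using root[of "2 * l", OF p(1) _ p(3)] p(2,4) by simp_all
  have "(l + m)\<^sup>2 \<noteq> \<nu>\<^sup>2" unfolding \<nu>2 using pos by (simp add: power2_eq_square algebra_simps)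
  then have q0: "q2 = 0" "q3 = 0" "q2' = 0" "q3' = 0"
    using root[OF q'] by simp_all
  have l2: "l\<^sup>2 = 9/40" and lm': "l * m = 3/40" using P Q' p0 q0 by simp_all
  have "l * (l - 3 * m) = l\<^sup>2 - 3 * (l * m)" by (simp add: algebra_simps power2_eq_square)
  also have "\<dots> = 0" using l2 lm' by simp
  finally have "l * (l - 3 * m) = 0" .
  then have l3: "l = 3 * m" using pos by simp
  have m2: "m\<^sup>2 = 1/40" using lm' l3 by (simp add: power2_eq_square)
  \<comment> \<open>The surviving roots \<open>2 * m\<close> and \<open>l - m\<close> both equal
    \<open>s * \<nu>\<close>; the sign \<open>s\<close> records the orientation of the two
    elements.\<close>
  define s where "s = 2 * m / \<nu>"
  have s: "2 * m = s * \<nu>" using \<nu> by (simp add: s_def)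
  have "\<nu>\<^sup>2 = (2 * m)\<^sup>2" using \<nu>2 l3 by simp
  then have ss: "s * s = 1" using \<nu> unfolding s by (simp add: power_mult_distrib flip: power2_eq_square)
  have e: "r2' = s * r3" "r3' = - s * r2" "q0' = s * q1" "q1' = - s * q0"
  proof -
    have lm2: "l - m = s * \<nu>" using l3 s by simp
    have "\<nu> * r2' = \<nu> * (s * r3)" "\<nu> * r3' = \<nu> * (- s * r2)" "\<nu> * q0' = \<nu> * (s * q1)" "\<nu> * q1' = \<nu> * (- s * q0)"
      using r(1,2) q(1,2) s lm2 by algebra+
    then show "r2' = s * r3" "r3' = - s * r2" "q0' = s * q1" "q1' = - s * q0"
      using \<nu> by (simp_all only: mult_cancel_left simp_thms)
  qed
  have sq: "(s * x)\<^sup>2 = x\<^sup>2" "(- s * x)\<^sup>2 = x\<^sup>2" for x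
    using ss by (simp_all add: power_mult_distrib power2_eq_square)
  show ?thesis
    using that[OF ss l3 m2 p0 q0 e] R Q m2 lm' unfolding e sq by simp
qed

lemma rank_analysis:
  fixes l m \<nu> :: real
  assumes lm: "0 \<le> m" "m \<le> l" "l \<noteq> 0" and \<nu>: "\<nu> = 0"
    and Q: "(q0\<^sup>2 + q1\<^sup>2 - p1 * r1) + (q0'\<^sup>2 + q1'\<^sup>2 - p1' * r1') - l * m = 3/40"
    and Q': "(q2\<^sup>2 + q3\<^sup>2 + p1 * r1) + (q2'\<^sup>2 + q3'\<^sup>2 + p1' * r1') + l * m = 3/40"
    and p: "2 * l * p3 = \<nu> * p2'" "- 2 * l * p2 = \<nu> * p3'" "2 * l * p3' = - \<nu> * p2" "- 2 * l * p2' = - \<nu> * p3"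
    and r: "2 * m * r3 = \<nu> * r2'" "- 2 * m * r2 = \<nu> * r3'" "2 * m * r3' = - \<nu> * r2" "- 2 * m * r2' = - \<nu> * r3"
    and q: "(l - m) * q1 = \<nu> * q0'" "- (l - m) * q0 = \<nu> * q1'" "(l - m) * q1' = - \<nu> * q0" "- (l - m) * q0' = - \<nu> * q1"
    and q': "(l + m) * q3 = \<nu> * q2'" "- (l + m) * q2 = \<nu> * q3'" "(l + m) * q3' = - \<nu> * q2" "- (l + m) * q2' = - \<nu> * q3"
    and HA: "l * p1 + m * r1 = 0" "l * p1' + m * r1' = 0"
  shows "p2 = 0" "p3 = 0" "p2' = 0" "p3' = 0" "q2 = 0" "q3 = 0" "q2' = 0" "q3' = 0"
    "r2 = 0" "r3 = 0" "r2' = 0" "r3' = 0" "r1 = - p1" "r1' = - p1'"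
proof -
  note p = p[unfolded \<nu>, simplified] and r = r[unfolded \<nu>, simplified]
    and q = q[unfolded \<nu>, simplified] and q' = q'[unfolded \<nu>, simplified]
  have "l + m \<noteq> 0" using lm by linarith
  then show q0: "q2 = 0" "q3 = 0" "q2' = 0" "q3' = 0" using q' by auto
  show "p2 = 0" "p3 = 0" "p2' = 0" "p3' = 0" using p lm by auto
  have "q0\<^sup>2 + q1\<^sup>2 + (q0'\<^sup>2 + q1'\<^sup>2) = 6/40"
    using Q Q' q0 by simp
  then have "\<not> (q0 = 0 \<and> q1 = 0 \<and> q0' = 0 \<and> q1' = 0)" by auto
  \<comment> \<open>With \<open>\<nu> = 0\<close> the coordinates \<open>q0\<close>,
    \<open>q1\<close> survive only if the root \<open>l - m\<close> is zero.\<close>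
  then have "l = m" using q by auto
  then show "r2 = 0" "r3 = 0" "r2' = 0" "r3' = 0" "r1 = - p1" "r1' = - p1'"
    using r HA lm by (simp_all flip: distrib_left) 
qed

text \<open>Three times the discriminant of the binary cubic with coefficients - x1 / sqrt 3, x2,
  x4, x3 / sqrt 3.\<close>

definition discr_quartic :: "complex \<Rightarrow> complex \<Rightarrow> complex \<Rightarrow> complex \<Rightarrow> complex" where
  "discr_quartic x1 x2 x3 x4 = - 18 * x1 * x2 * x3 * x4
     + 4 * complex_of_real (sqrt 3) * x1 * x4^3 - 4 * complex_of_real (sqrt 3) * x2^3 * x3
     + 3 * x2^2 * x4^2 - 9 * x1^2 * x3^2"

section \<open>Hyper-Hermitian spaces and the algebra sp(2)\<close>

locale hyper_hermitian_space =
  fixes J1 J2 J3 :: "'v::euclidean_space \<Rightarrow>\<^sub>L 'v"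
  assumes hh: "hyper_hermitian J1 J2 J3"
begin

lemma J_mult [simp]:
  "J1 (J1 x) = - x" "J1 (J2 x) = J3 x" "J1 (J3 x) = - J2 x"
  "J2 (J1 x) = - J3 x" "J2 (J2 x) = - x" "J2 (J3 x) = J1 x"
  "J3 (J1 x) = J2 x" "J3 (J2 x) = - J1 x" "J3 (J3 x) = - x"
proof -
  have sq: "J1 (J1 x) = - x" "J2 (J2 x) = - x" "J3 (J3 x) = - x" for x
    using hh[unfolded hyper_hermitian_def] 
    by (auto dest!: arg_cong[where f = "\<lambda>f. blinfun_apply f x"] simp: blinfun.bilinear_simps)
  have J3: "J1 o\<^sub>L J2 = J3" "- (J2 o\<^sub>L J1) = J3"
    using hh[unfolded hyper_hermitian_def] by blast+
  have a: "J1 (J2 x) = J3 x" "J2 (J1 x) = - J3 x" for x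
    using arg_cong[OF J3(1), of "\<lambda>f. blinfun_apply f x"]
      arg_cong[OF J3(2), of "\<lambda>f. blinfun_apply f x"]
    by (simp_all add: blinfun.bilinear_simps) (metis minus_minus)
  show "J1 (J1 x) = - x" "J2 (J2 x) = - x" "J3 (J3 x) = - x"
    "J1 (J2 x) = J3 x" "J2 (J1 x) = - J3 x" by (fact sq a)+
  show "J1 (J3 x) = - J2 x" using a(1)[of x] sq(1)[of "J2 x"] by simp
  show "J2 (J3 x) = J1 x" using a(2)[of x] sq(2)[of "J1 x"] 
    by (simp add: blinfun.bilinear_simps)
  show "J3 (J1 x) = J2 x" using a(1)[of "J1 x"] a(2)[of x] a(1)[of x] sq(1)[of "J2 x"]
    by (simp add: blinfun.bilinear_simps)
  show "J3 (J2 x) = - J1 x" using a(1)[of "J2 x"] sq(2)[of x]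
    by (simp add: blinfun.bilinear_simps)
qed

lemma J_inner [simp]: "J1 x \<bullet> y = - (x \<bullet> J1 y)" "J2 x \<bullet> y = - (x \<bullet> J2 y)" "J3 x \<bullet> y = - (x \<bullet> J3 y)"
proof -
  have o: "J1 x \<bullet> J1 y = x \<bullet> y" "J2 x \<bullet> J2 y = x \<bullet> y" "J3 x \<bullet> J3 y = x \<bullet> y" for x y
    using hh[unfolded hyper_hermitian_def] by blast+
  show "J1 x \<bullet> y = - (x \<bullet> J1 y)" using o(1)[of x "J1 y"] by simp
  show "J2 x \<bullet> y = - (x \<bullet> J2 y)" using o(2)[of x "J2 y"] by simp
  show "J3 x \<bullet> y = - (x \<bullet> J3 y)" using o(3)[of x "J3 y"] by simp
qed

lemma J_inner_self [simp]: "x \<bullet> J1 x = 0" "x \<bullet> J2 x = 0" "x \<bullet> J3 x = 0"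
  using J_inner[of x x] by (simp_all add: inner_commute)

lemma J_inner_swap: "y \<bullet> J1 z = - (z \<bullet> J1 y)" "y \<bullet> J2 z = - (z \<bullet> J2 y)" "y \<bullet> J3 z = - (z \<bullet> J3 y)"
  by (simp_all add: inner_commute[of y])

declare blinfun.bilinear_simps [simp]

lemma sp2D:
  fixes A :: "'v \<Rightarrow>\<^sub>L 'v"
  assumes "A \<in> sp2 J1 J2 J3"
  shows "A x \<bullet> y = - (x \<bullet> A y)" "A (J1 x) = J1 (A x)" "A (J2 x) = J2 (A x)" "A (J3 x) = J3 (A x)"
proof -
  have s: "A x \<bullet> y + x \<bullet> A y = 0" and c: "A o\<^sub>L J1 = J1 o\<^sub>L A" "A o\<^sub>L J2 = J2 o\<^sub>L A" "A o\<^sub>L J3 = J3 o\<^sub>L A"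
    using assms unfolding sp2_def by blast+
  show "A x \<bullet> y = - (x \<bullet> A y)" using s by linarith
  show "A (J1 x) = J1 (A x)" "A (J2 x) = J2 (A x)" "A (J3 x) = J3 (A x)"
    using arg_cong[OF c(1), of "\<lambda>f. blinfun_apply f x"] arg_cong[OF c(2), of "\<lambda>f. blinfun_apply f x"]
      arg_cong[OF c(3), of "\<lambda>f. blinfun_apply f x"] by simp_all
qed

lemma sp2I:
  fixes A :: "'v \<Rightarrow>\<^sub>L 'v"
  assumes "\<And>x y. A x \<bullet> y = - (x \<bullet> A y)" "\<And>x. A (J1 x) = J1 (A x)" "\<And>x. A (J2 x) = J2 (A x)"
  shows "A \<in> sp2 J1 J2 J3"
proof -
  have "A (J3 x) = J3 (A x)" for x
    by (metis assms(2,3) J_mult(2))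
  then show ?thesis
    using assms by (auto simp: sp2_def intro!: blinfun_eqI)
qed

abbreviation "sp \<equiv> sp2 J1 J2 J3"

lemma sp2_inner_self [simp]:
  fixes A :: "'v \<Rightarrow>\<^sub>L 'v"
  shows "A \<in> sp \<Longrightarrow> A x \<bullet> x = 0" "A \<in> sp \<Longrightarrow> x \<bullet> A x = 0"
  using sp2D(1)[of A x x] by (simp_all add: inner_commute)

lemma sp2_add: "A \<in> sp \<Longrightarrow> B \<in> sp \<Longrightarrow> A + B \<in> sp"
  by (rule sp2I) (simp_all add: sp2D[of A] sp2D[of B] inner_left_distrib inner_right_distrib)

lemma sp2_scaleR: "A \<in> sp \<Longrightarrow> r *\<^sub>R A \<in> sp"
  by (rule sp2I) (simp_all add: sp2D)

lemma sp2_minus: "A \<in> sp \<Longrightarrow> - A \<in> sp"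
  using sp2_scaleR[of A "-1"] by simp

lemma sp2_diff: "A \<in> sp \<Longrightarrow> B \<in> sp \<Longrightarrow> A - B \<in> sp"
  using sp2_add[of A "- B"] sp2_minus[of B] by simp

lemma sp2_bracket: "A \<in> sp \<Longrightarrow> B \<in> sp \<Longrightarrow> bracket A B \<in> sp"
  by (rule sp2I) (simp_all add: sp2D[of A] sp2D[of B] bracket_apply inner_diff_left inner_diff_right)

lemma sp2_zero: "0 \<in> sp"
  by (rule sp2I) simp_all

lemmas sp2_closed = sp2_zero sp2_add sp2_scaleR sp2_minus sp2_diff sp2_bracket

lemma sp2_sum: "(\<And>i. i \<in> I \<Longrightarrow> f i \<in> sp) \<Longrightarrow> (\<Sum>i\<in>I. f i) \<in> sp"
  by (induction I rule: infinite_finite_induct) (auto intro: sp2_closed)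

text \<open>An element of sp(2) is a skew-Hermitian quaternionic matrix, so one off-diagonal entry
  determines the other. In a frame ten real coordinates remain: three for each diagonal entry and
  four off the diagonal.\<close>

lemma sp2_frame_swap:
  fixes A :: "'v \<Rightarrow>\<^sub>L 'v"
  assumes "A \<in> sp"
  shows "A v \<bullet> u = - (A u \<bullet> v)" "A v \<bullet> J1 u = A u \<bullet> J1 v" "A v \<bullet> J2 u = A u \<bullet> J2 v" "A v \<bullet> J3 u = A u \<bullet> J3 v"
  using sp2D(1)[OF assms, of v u]
  by (simp_all only: sp2D(1)[OF assms, of v] sp2D(2-4)[OF assms] J_inner_swap[of v "A u"] minus_minus
     inner_commute[of v "A u"])

text \<open>Four times the orthogonal projection of \<open>wedge_op z w\<close> to \<open>sp(2)\<close>.\<close>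

definition sp2_wedge :: "'v \<Rightarrow> 'v \<Rightarrow> 'v \<Rightarrow>\<^sub>L 'v" where
  "sp2_wedge z w = wedge_op z w + wedge_op (J1 z) (J1 w) + wedge_op (J2 z) (J2 w) + wedge_op (J3 z) (J3 w)"

lemma sp2_wedge_apply:
  "sp2_wedge z w x = (z \<bullet> x) *\<^sub>R w - (w \<bullet> x) *\<^sub>R z
     - (z \<bullet> J1 x) *\<^sub>R J1 w + (w \<bullet> J1 x) *\<^sub>R J1 z
     - (z \<bullet> J2 x) *\<^sub>R J2 w + (w \<bullet> J2 x) *\<^sub>R J2 z
     - (z \<bullet> J3 x) *\<^sub>R J3 w + (w \<bullet> J3 x) *\<^sub>R J3 z"
  by (simp add: sp2_wedge_def wedge_op_apply)

lemma sp2_wedge_in_sp2: "sp2_wedge z w \<in> sp"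
proof (rule sp2I)
  show "sp2_wedge z w x \<bullet> y = - (x \<bullet> sp2_wedge z w y)" for x y
    by (simp add: sp2_wedge_apply J_inner_swap[of y] inner_left_distrib inner_right_distrib inner_diff_left inner_diff_right
        inner_commute[of x] inner_commute[of _ y])
qed (simp_all add: sp2_wedge_apply)

text \<open>Each of the four wedges in \<open>sp2_wedge\<close> contributes
  \<open>2 * (A z \<bullet> w)\<close>. Matrix coefficients of \<open>A\<close> thus become pairings
  with elements of sp(2).\<close>

lemma frob_sp2_wedge:
  fixes A :: "'v \<Rightarrow>\<^sub>L 'v"
  assumes "A \<in> sp"
  shows "frob A (sp2_wedge z w) = 8 * (A z \<bullet> w)"
proof -
  have l: "(\<Sum>h\<in>Basis. (z \<bullet> h) * (A h \<bullet> w)) = A z \<bullet> w" for z w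
    using inner_Basis_apply[of z A w] by (simp add: inner_commute)
  have "frob A (sp2_wedge z w) = (\<Sum>h\<in>Basis. A h \<bullet> ((z \<bullet> h) *\<^sub>R w - (w \<bullet> h) *\<^sub>R z
     + (J1 z \<bullet> h) *\<^sub>R J1 w - (J1 w \<bullet> h) *\<^sub>R J1 z
     + (J2 z \<bullet> h) *\<^sub>R J2 w - (J2 w \<bullet> h) *\<^sub>R J2 z
     + (J3 z \<bullet> h) *\<^sub>R J3 w - (J3 w \<bullet> h) *\<^sub>R J3 z))"
    unfolding frob_def by (intro sum.cong refl arg_cong2[where f = inner]) (simp add: sp2_wedge_apply)
  also have "\<dots> = A z \<bullet> w - A w \<bullet> z + A (J1 z) \<bullet> J1 w - A (J1 w) \<bullet> J1 z
     + A (J2 z) \<bullet> J2 w - A (J2 w) \<bullet> J2 z + A (J3 z) \<bullet> J3 w - A (J3 w) \<bullet> J3 z"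
    unfolding inner_diff_right inner_add_right inner_scaleR_right sum.distrib sum_subtractf l ..
  also have "\<dots> = 8 * (A z \<bullet> w)"
    using sp2D(1)[OF assms, of w z] by (simp add: sp2D(2-4)[OF assms] inner_commute)
  finally show ?thesis .
qed

text \<open>The contraction that turns \<open>sp2_wedge\<close> into a multiple of the identity of
  sp(2); it yields the scalar part of the operator in \<open>curv_op_frob_form\<close>.\<close>

lemma sum_sp2_wedge:
  fixes A :: "'v \<Rightarrow>\<^sub>L 'v"
  assumes "A \<in> sp"
  shows "(\<Sum>h\<in>Basis. sp2_wedge h (A h) x \<bullet> y) = 8 * (A x \<bullet> y)"
proof -
  have l: "(\<Sum>h\<in>Basis. (h \<bullet> x) * (A h \<bullet> y)) = A x \<bullet> y" for x y
    by (rule inner_Basis_apply)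
  have "(\<Sum>h\<in>Basis. sp2_wedge h (A h) x \<bullet> y) = (\<Sum>h\<in>Basis. (h \<bullet> x) * (A h \<bullet> y) - (h \<bullet> y) * (A h \<bullet> x)
     + (h \<bullet> J1 x) * (A h \<bullet> J1 y) - (h \<bullet> J1 y) * (A h \<bullet> J1 x)
     + (h \<bullet> J2 x) * (A h \<bullet> J2 y) - (h \<bullet> J2 y) * (A h \<bullet> J2 x)
     + (h \<bullet> J3 x) * (A h \<bullet> J3 y) - (h \<bullet> J3 y) * (A h \<bullet> J3 x))"
    by (intro sum.cong refl)
      (simp add: sp2_wedge_apply inner_left_distrib inner_diff_left algebra_simps)
  also have "\<dots> = A x \<bullet> y - A y \<bullet> x + A (J1 x) \<bullet> J1 y - A (J1 y) \<bullet> J1 x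
     + A (J2 x) \<bullet> J2 y - A (J2 y) \<bullet> J2 x + A (J3 x) \<bullet> J3 y - A (J3 y) \<bullet> J3 x"
    unfolding sum.distrib sum_subtractf l ..
  also have "\<dots> = 8 * (A x \<bullet> y)"
    using sp2D(1)[OF assms, of y x] by (simp add: sp2D(2-4)[OF assms] inner_commute)
  finally show ?thesis .
qed

text \<open>
  A pair \<open>u, v\<close> that is orthonormal over the quaternions; the adapted bases of \<open>W\<close> are the images
  of such pairs under \<open>to_W\<close>, up to the factor \<open>sqrt 2\<close>.
\<close>

definition frame :: "'v \<Rightarrow> 'v \<Rightarrow> bool" where
  "frame u v \<longleftrightarrow> u \<bullet> u = 1 \<and> v \<bullet> v = 1 \<and>
     u \<bullet> v = 0 \<and> u \<bullet> J1 v = 0 \<and> u \<bullet> J2 v = 0 \<and> u \<bullet> J3 v = 0"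

lemma frame_inner:
  assumes "frame u v"
  shows "u \<bullet> u = 1" "v \<bullet> v = 1" "u \<bullet> v = 0" "u \<bullet> J1 v = 0" "u \<bullet> J2 v = 0" "u \<bullet> J3 v = 0"
    "v \<bullet> u = 0" "v \<bullet> J1 u = 0" "v \<bullet> J2 u = 0" "v \<bullet> J3 u = 0"
  using assms J_inner_swap[of v u] by (simp_all add: frame_def inner_commute)

lemma frame_sym: "frame u v \<Longrightarrow> frame v u"
  by (simp add: frame_def[of v u] frame_inner[of u v])

text \<open>For a unit vector \<open>u\<close>, the orthogonal projection to its quaternionic
  line.\<close>

definition line_part :: "'v \<Rightarrow> 'v \<Rightarrow> 'v" where
  "line_part u x = (x \<bullet> u) *\<^sub>R u + (x \<bullet> J1 u) *\<^sub>R J1 u + (x \<bullet> J2 u) *\<^sub>R J2 u + (x \<bullet> J3 u) *\<^sub>R J3 u"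

lemma frame_expand:
  assumes "DIM('v) = 8" and fr: "frame u v"
  shows "x = line_part u x + line_part v x"
proof -
  let ?L = "[u, J1 u, J2 u, J3 u, v, J1 v, J2 v, J3 v]"
  note [simp] = frame_inner[OF fr]
  have ne: "a \<noteq> b" if "a \<bullet> b = 0" "b \<bullet> b = 1" for a b :: 'v
    using that by auto
  have d: "distinct ?L"
    by (simp, intro conjI ne) simp_all
  have o: "pairwise orthogonal (set ?L)"
    by (auto simp: pairwise_def orthogonal_def)
  have n: "norm b = 1" if "b \<in> set ?L" for b
    using that by (auto simp: norm_eq_1)
  have "0 \<notin> set ?L" using n by fastforce
  then have i: "independent (set ?L)"
    using o by (rule pairwise_orthogonal_independent[rotated])
  have "card (set ?L) = DIM('v)"
    using distinct_card[OF d] assms(1) by simp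
  then have "span (set ?L) = UNIV"
    using i by (metis card_eq_dim dim_UNIV finite_set subset_UNIV top.extremum_unique)
  then have "(\<Sum>b\<in>set ?L. (x \<bullet> b) *\<^sub>R b) = x"
    using o n by (intro orthonormal_basis_expand) auto
  moreover have "(\<Sum>b\<in>set ?L. (x \<bullet> b) *\<^sub>R b) = sum_list (map (\<lambda>b. (x \<bullet> b) *\<^sub>R b) ?L)"
    by (rule sum.distinct_set_conv_list[OF d])
  ultimately show ?thesis by (simp add: line_part_def add.assoc)
qed

lemma sp2_line_part:
  fixes A :: "'v \<Rightarrow>\<^sub>L 'v"
  assumes "A \<in> sp"
  shows "A (line_part u x) =
     (x \<bullet> u) *\<^sub>R A u + (x \<bullet> J1 u) *\<^sub>R J1 (A u) + (x \<bullet> J2 u) *\<^sub>R J2 (A u) + (x \<bullet> J3 u) *\<^sub>R J3 (A u)"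
  by (simp add: line_part_def sp2D[OF assms])

lemma sp2_eqI:
  fixes A B :: "'v \<Rightarrow>\<^sub>L 'v"
  assumes "DIM('v) = 8" "frame u v" "A \<in> sp" "B \<in> sp" "A u = B u" "A v = B v"
  shows "A = B"
proof (rule blinfun_eqI)
  fix x
  have "A (line_part u x + line_part v x) = B (line_part u x + line_part v x)"
    by (simp add: sp2_line_part assms)
  then show "A x = B x" by (simp only: frame_expand[OF assms(1,2), symmetric])
qed

text \<open>At \<open>u\<close> the first wedge returns \<open>A u\<close> plus its part along the
  line of \<open>u\<close>, and the second, by \<open>sp2_frame_swap\<close>, its part along the
  line of \<open>v\<close>; hence the factor 2. Exchanging the roles settles
  \<open>v\<close>.\<close>

lemma sp2_eq_sum_wedges:
  fixes A :: "'v \<Rightarrow>\<^sub>L 'v"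
  assumes d: "DIM('v) = 8" and fr: "frame u v" and A: "A \<in> sp"
  shows "2 *\<^sub>R A = sp2_wedge u (A u) + sp2_wedge v (A v)"
proof -
  have e: "2 *\<^sub>R A u = (sp2_wedge u (A u) + sp2_wedge v (A v)) u" if fr: "frame u v" for u v
  proof -
    note [simp] = frame_inner[OF fr]
    have s: "A v \<bullet> u = - (A u \<bullet> v)" "A v \<bullet> J1 u = A u \<bullet> J1 v" "A v \<bullet> J2 u = A u \<bullet> J2 v"
      "A v \<bullet> J3 u = A u \<bullet> J3 v"
      by (rule sp2_frame_swap[OF A])+
    have "(sp2_wedge u (A u) + sp2_wedge v (A v)) u = A u + line_part u (A u) + line_part v (A u)"
      using A by (simp add: sp2_wedge_apply line_part_def s)
    then show ?thesis
      using frame_expand[OF d fr, of "A u"] by (simp add: scaleR_2)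
  qed
  show ?thesis
    using e[OF fr] e[OF frame_sym[OF fr]] A
    by (intro sp2_eqI[OF d fr]) (simp_all add: sp2_closed sp2_wedge_in_sp2 add.commute)
qed

text \<open>The factor 4 counts each of \<open>u\<close>, \<open>v\<close> together with its images
  under \<open>J1\<close>, \<open>J2\<close>, \<open>J3\<close>. Writing \<open>B\<close> as a sum
  of wedges avoids a change of orthonormal basis.\<close>

lemma frob_frame:
  fixes A B :: "'v \<Rightarrow>\<^sub>L 'v"
  assumes "DIM('v) = 8" "frame u v" "A \<in> sp" "B \<in> sp"
  shows "frob A B = 4 * (A u \<bullet> B u + A v \<bullet> B v)"
proof -
  have "2 * frob A B = frob A (sp2_wedge u (B u) + sp2_wedge v (B v))"
    unfolding sp2_eq_sum_wedges[OF assms(1,2,4), symmetric] by (simp add: frob_bilinear)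
  then show ?thesis using assms(3) by (simp add: frob_bilinear frob_sp2_wedge)
qed

section \<open>Curvature-type tensors and their operators on sp(2)\<close>

context
  fixes K :: "'v \<Rightarrow> 'v \<Rightarrow> 'v \<Rightarrow> 'v \<Rightarrow> real"
  assumes K: "K \<in> curv_sp2 J1 J2 J3"
begin

lemma curv_linear:
  "linear (\<lambda>x. K x y z w)" "linear (\<lambda>y. K x y z w)"
  "linear (\<lambda>z. K x y z w)" "linear (\<lambda>w. K x y z w)"
proof -
  have l: "(\<forall>y z w. linear (\<lambda>x. K x y z w)) \<and> (\<forall>x z w. linear (\<lambda>y. K x y z w)) \<and>
      (\<forall>x y w. linear (\<lambda>z. K x y z w)) \<and> (\<forall>x y z. linear (\<lambda>w. K x y z w))"
    using K unfolding curv_sp2_def mem_Collect_eq by - (elim conjE, intro conjI; assumption)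
  show "linear (\<lambda>x. K x y z w)" "linear (\<lambda>y. K x y z w)"
    "linear (\<lambda>z. K x y z w)" "linear (\<lambda>w. K x y z w)"
    using l by metis+
qed

lemma curv_add:
  "K (x + x') y z w = K x y z w + K x' y z w" "K x (y + y') z w = K x y z w + K x y' z w"
  "K x y (z + z') w = K x y z w + K x y z' w" "K x y z (w + w') = K x y z w + K x y z w'"
  using curv_linear by (simp_all add: linear_iff)

lemma curv_scale:
  "K (r *\<^sub>R x) y z w = r * K x y z w" "K x (r *\<^sub>R y) z w = r * K x y z w"
  "K x y (r *\<^sub>R z) w = r * K x y z w" "K x y z (r *\<^sub>R w) = r * K x y z w"
  using curv_linear by (simp_all add: linear_iff)

lemma curv_minus:
  "K (- x) y z w = - K x y z w" "K x (- y) z w = - K x y z w"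
  "K x y (- z) w = - K x y z w" "K x y z (- w) = - K x y z w"
  using curv_scale(1)[of "-1"] curv_scale(2)[of _ "-1"] curv_scale(3)[of _ _ "-1"]
    curv_scale(4)[of _ _ _ "-1"]
  by simp_all

lemma curv_diff:
  "K (x - x') y z w = K x y z w - K x' y z w" "K x (y - y') z w = K x y z w - K x y' z w"
  "K x y (z - z') w = K x y z w - K x y z' w" "K x y z (w - w') = K x y z w - K x y z w'"
  by (simp_all only: diff_conv_add_uminus curv_add curv_minus)

lemma curv_skew: "K y x z w = - K x y z w" "K x y w z = - K x y z w"
  and curv_bianchi: "K x y z w + K y z x w + K z x y w = 0"
  using K unfolding curv_sp2_def by blast+

text \<open>The classical argument: four Bianchi identities, one for each choice of the last
  argument, combined through the skew symmetries.\<close>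

lemma curv_pair: "K x y z w = K z w x y"
proof -
  have s1: "K y x z w = - K x y z w" and s2: "K x y w z = - K x y z w" for x y z w
    by (rule curv_skew)+
  show ?thesis
    using curv_bianchi[of x y z w] curv_bianchi[of y z w x] curv_bianchi[of z w x y]
      curv_bianchi[of w x y z] s1[of x y z w] s1[of y z w x] s1[of z w x y] s1[of w x y z]
      s1[of x z y w] s1[of y w z x] s1[of w y z x] s1[of z x y w] s1[of w y x z] s1[of x z w y]
      s2[of x y w z] s2[of y z x w] s2[of z w x y] s2[of w x y z] s2[of x z w y] s2[of y w z x]
      s2[of z x y w] s2[of w y z x] s2[of w y x z] s2[of x y z w]
    by linarith
qed

lemma curv_J:
  "K x y (J1 z) w = - K x y z (J1 w)" "K x y (J2 z) w = - K x y z (J2 w)"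
  "K x y (J3 z) w = - K x y z (J3 w)"
proof -
  have i: "K x y (J1 z) (J1 w) = K x y z w" "K x y (J2 z) (J2 w) = K x y z w"
     "K x y (J3 z) (J3 w) = K x y z w" for z w
    using K unfolding curv_sp2_def by blast+
  show "K x y (J1 z) w = - K x y z (J1 w)" "K x y (J2 z) w = - K x y z (J2 w)"
    "K x y (J3 z) w = - K x y z (J3 w)"
    using i(1)[of z "J1 w"] i(2)[of z "J2 w"] i(3)[of z "J3 w"] by (simp_all add: curv_minus)
qed

lemma curv_J':
  "K (J1 x) y z w = - K x (J1 y) z w" "K (J2 x) y z w = - K x (J2 y) z w"
  "K (J3 x) y z w = - K x (J3 y) z w"
  using curv_J[of z w x y] by (simp_all add: curv_pair[of _ _ z w])

lemma curv_op_Basis: "curv_op K A x \<bullet> y = 1/2 * (\<Sum>h\<in>Basis. K x y h (A h))"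
  by (rule curv_op_inner[OF K])
    (auto simp: pairwise_def orthogonal_def inner_Basis span_Basis)

text \<open>By \<open>J\<close>-invariance the four wedges in \<open>sp2_wedge\<close> contribute
  equally. The tensor is therefore recovered from its operator on sp(2).\<close>

lemma curv_op_sp2_wedge: "curv_op K (sp2_wedge z w) x \<bullet> y = 4 * K x y z w"
proof -
  have l: "(\<Sum>h\<in>Basis. (z \<bullet> h) * K x y h w) = K x y z w" for z w
    using inner_Basis_expand[OF curv_linear(3), of z] by (simp add: inner_commute)
  have e: "K x y h (sp2_wedge z w h) = (z \<bullet> h) * K x y h w - (w \<bullet> h) * K x y h z
     + (J1 z \<bullet> h) * K x y h (J1 w) - (J1 w \<bullet> h) * K x y h (J1 z)
     + (J2 z \<bullet> h) * K x y h (J2 w) - (J2 w \<bullet> h) * K x y h (J2 z)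
     + (J3 z \<bullet> h) * K x y h (J3 w) - (J3 w \<bullet> h) * K x y h (J3 z)" for h
    by (simp add: sp2_wedge_apply curv_add curv_diff curv_scale)
  show ?thesis
    unfolding curv_op_Basis e sum.distrib sum_subtractf l
    by (simp add: curv_J curv_minus curv_skew(2)[of x y w z])
qed

lemma curv_op_linear:
  "curv_op K (A + B) = curv_op K A + curv_op K B"
  "curv_op K (A - B) = curv_op K A - curv_op K B"
  "curv_op K (r *\<^sub>R A) = r *\<^sub>R curv_op K A"
proof -
  have eq: "S = T" if "\<And>x y. S x \<bullet> y = T x \<bullet> y" for S T :: "'v \<Rightarrow>\<^sub>L 'v"
    using that by (intro blinfun_eqI) (meson vector_eq_rdot)
  show "curv_op K (A + B) = curv_op K A + curv_op K B"
    "curv_op K (A - B) = curv_op K A - curv_op K B"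
    "curv_op K (r *\<^sub>R A) = r *\<^sub>R curv_op K A"
    by (rule eq, simp add: curv_op_Basis curv_add curv_diff curv_scale inner_left_distrib
        inner_diff_left sum.distrib sum_subtractf add_divide_distrib diff_divide_distrib
        flip: sum_distrib_left)+
qed

text \<open>Pair symmetry of \<open>K\<close>. It makes the idempotent obtained from condition (I)
  an orthogonal projection.\<close>

lemma curv_op_sym: "frob (curv_op K A) B = frob A (curv_op K B)"
proof -
  have "frob (curv_op K A) B = 1/2 * (\<Sum>k\<in>Basis. \<Sum>h\<in>Basis. K k (B k) h (A h))"
    by (simp add: frob_def curv_op_Basis sum_distrib_left)
  also have "\<dots> = 1/2 * (\<Sum>h\<in>Basis. \<Sum>k\<in>Basis. K k (B k) h (A h))"
    by (subst sum.swap) simp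
  also have "\<dots> = 1/2 * (\<Sum>h\<in>Basis. \<Sum>k\<in>Basis. K h (A h) k (B k))"
    by (simp add: curv_pair[of _ _ _ "blinfun_apply A _"])
  also have "\<dots> = frob (curv_op K B) A"
    by (simp add: frob_def curv_op_Basis sum_distrib_left)
  finally show ?thesis by (simp add: frob_commute)
qed

end

section \<open>The quartic form on W\<close>

text \<open>
  The map \<open>to_W\<close> identifies \<open>(V, J1)\<close> with \<open>W\<close> as complex vector spaces; under it the complex
  extension of \<open>S_tensor\<close> to \<open>W\<close> becomes \<open>4 S_cpx\<close>, see \<open>cext4_S_tensor\<close>.
\<close>

definition S_cpx :: "('v \<Rightarrow> 'v \<Rightarrow> 'v \<Rightarrow> 'v \<Rightarrow> real) \<Rightarrow> 'v \<Rightarrow> 'v \<Rightarrow> 'v \<Rightarrow> 'v \<Rightarrow> complex" where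
  "S_cpx K x y z w = Complex (K x (J2 y) z (J2 w) - K x (J3 y) z (J3 w))
     (K x (J2 y) z (J3 w) + K x (J3 y) z (J2 w))"

definition J1_scale :: "complex \<Rightarrow> 'v \<Rightarrow> 'v" where
  "J1_scale c x = Re c *\<^sub>R x + Im c *\<^sub>R J1 x"

definition to_W :: "'v \<Rightarrow> 'v complexified" where
  "to_W x = (x, - J1 x)"

context
  fixes K :: "'v \<Rightarrow> 'v \<Rightarrow> 'v \<Rightarrow> 'v \<Rightarrow> real"
  assumes K: "K \<in> curv_sp2 J1 J2 J3"
begin

lemma S_cpx_swap12: "S_cpx K y x z w = S_cpx K x y z w"
proof -
  have "K y (J2 x) z w = K x (J2 y) z w" "K y (J3 x) z w = K x (J3 y) z w" for z w
    using curv_skew(1)[OF K, of y "J2 x" z w] curv_J'(2)[OF K, of x y z w]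
      curv_skew(1)[OF K, of y "J3 x" z w] curv_J'(3)[OF K, of x y z w] by simp_all
  then show ?thesis by (simp add: S_cpx_def)
qed

lemma S_cpx_swap34: "S_cpx K x y w z = S_cpx K x y z w"
proof -
  have "K x y w (J2 z) = K x y z (J2 w)" "K x y w (J3 z) = K x y z (J3 w)" for x y
    using curv_skew(2)[OF K, of x y w "J2 z"] curv_J(2)[OF K, of x y z w]
      curv_skew(2)[OF K, of x y w "J3 z"] curv_J(3)[OF K, of x y z w] by simp_all
  then show ?thesis by (simp add: S_cpx_def)
qed

text \<open>The Bianchi identity leaves correction terms with \<open>z\<close>, \<open>x\<close> in
  front. In the real part both equal \<open>K z x y w\<close> and cancel; in the imaginary part they
  cancel because \<open>J2\<close> and \<open>J3\<close> anticommute.\<close>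

lemma S_cpx_swap13: "S_cpx K z y x w = S_cpx K x y z w"
proof -
  have b: "K x y z w = K z y x w - K z x y w" for x y z w
    using curv_bianchi[OF K, of x y z w] curv_skew(1)[OF K, of y z x w] by simp
  note s = curv_J[OF K] curv_minus[OF K]
  show ?thesis
    unfolding S_cpx_def b[of x _ z] by (simp add: s)
qed

lemma S_cpx_swap23: "S_cpx K x z y w = S_cpx K x y z w"
  by (metis S_cpx_swap12 S_cpx_swap13)

lemma S_cpx_J1: "S_cpx K (J1 x) y z w = \<i> * S_cpx K x y z w"
  by (intro complex_eqI) (simp_all add: S_cpx_def curv_J'[OF K] curv_minus[OF K])

lemma S_cpx_add: "S_cpx K (x + x') y z w = S_cpx K x y z w + S_cpx K x' y z w"
  by (intro complex_eqI) (simp_all add: S_cpx_def curv_add[OF K])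

lemma S_cpx_scaleR: "S_cpx K (r *\<^sub>R x) y z w = of_real r * S_cpx K x y z w"
  by (intro complex_eqI) (simp_all add: S_cpx_def curv_scale[OF K] algebra_simps)

lemma S_cpx_minus: "S_cpx K (- x) y z w = - S_cpx K x y z w"
  using S_cpx_scaleR[of "-1"] by simp

lemma cext4_S_tensor:
  "cext4 (S_tensor J2 J3 K) (to_W x) (to_W y) (to_W z) (to_W w) = 4 * S_cpx K x y z w"
proof -
  have swap: "S_cpx K x y z w = S_cpx K y x z w" "S_cpx K x y z w = S_cpx K z y x w"
    "S_cpx K x y z w = S_cpx K w y z x" for x y z w
    by (rule S_cpx_swap12[symmetric], rule S_cpx_swap13[symmetric],
        rule trans[OF S_cpx_swap34[symmetric] trans[OF S_cpx_swap13[symmetric] S_cpx_swap34]])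
  have J: "S_cpx K x (J1 y) z w = \<i> * S_cpx K x y z w" "S_cpx K x y (J1 z) w = \<i> * S_cpx K x y z w"
    "S_cpx K x y z (J1 w) = \<i> * S_cpx K x y z w" for x y z w
    by (simp_all only: swap(1)[of x "J1 y"] swap(2)[of x y "J1 z"] swap(3)[of x y z "J1 w"] S_cpx_J1
        swap(1)[of y x z w] swap(2)[of z y x w] swap(3)[of w y z x])
  have m: "S_cpx K x (- y) z w = - S_cpx K x y z w" "S_cpx K x y (- z) w = - S_cpx K x y z w"
    "S_cpx K x y z (- w) = - S_cpx K x y z w" for x y z w
    by (simp_all only: swap(1)[of x "- y"] swap(2)[of x y "- z"] swap(3)[of x y z "- w"] S_cpx_minus
        swap(1)[of y x z w] swap(2)[of z y x w] swap(3)[of w y z x])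
  have S: "S_tensor J2 J3 K x y z w = Re (S_cpx K x y z w) / 2" for x y z w
    by (simp add: S_tensor_def S_cpx_def)
  \<comment> \<open>\<open>S_tensor\<close> is half the real part of a complex multilinear form. The
    first complexified argument restores the complex value, and each of the other three doubles it,
    giving 1/2 * 8 = 4.\<close>
  have 1: "cext1 (\<lambda>w'. complex_of_real (S_tensor J2 J3 K x y z w')) (to_W w) = S_cpx K x y z w / 2"
    for x y z w
    by (intro complex_eqI) (simp_all add: cext1_def to_W_def S m J)
  have 2: "cext1 (\<lambda>z'. S_cpx K x y z' w / 2) (to_W z) = S_cpx K x y z w" for x y
    by (simp add: cext1_def to_W_def m(2) J(2))
  have 3: "cext1 (\<lambda>y'. S_cpx K x y' z w) (to_W y) = 2 * S_cpx K x y z w" for x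
    by (simp add: cext1_def to_W_def m(1) J(1))
  have 4: "cext1 (\<lambda>x'. 2 * S_cpx K x' y z w) (to_W x) = 4 * S_cpx K x y z w"
    unfolding cext1_def to_W_def fst_conv snd_conv S_cpx_minus S_cpx_J1 by (simp add: complex_eq_iff)
  show ?thesis
    unfolding cext4_def 1 2 3 4 ..
qed

end

text \<open>
  The hypothesis says that \<open>D\<close> vanishes on \<open>W \<times> W' \<times> W \<times> W'\<close>, \<open>W'\<close> the conjugate of \<open>W\<close>; skew symmetry
  and \<open>J1\<close>-invariance kill the remaining components.
\<close>

lemma S_cpx_eq_0D:
  assumes skew: "\<And>x y z w. D x y w z = - D x y z w"
    and J1: "\<And>x y z w. D x y (J1 z) w = - D x y z (J1 w)"
    and 0: "\<And>x y z w. S_cpx D x y z w = 0"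
  shows "D x y z w = 0"
proof -
  \<comment> \<open>With \<open>- J2 y\<close> and \<open>- J2 w\<close> inserted, the
    \<open>J2\<close> term is the value at \<open>y\<close>, \<open>w\<close> and the
    \<open>J3\<close> term the value at \<open>J1 y\<close>, \<open>J1 w\<close>.\<close>
  have a: "D x y z w = D x (J1 y) z (J1 w)" for x y z w
    using 0[of x "- J2 y" z "- J2 w"] by (simp add: S_cpx_def complex_eq_iff)
  have "D x y z w = D x (J1 y) w (J1 z)"
    using a[of x y z w] J1[of x "J1 y" w z] skew[of x "J1 y" z "J1 w"] by linarith
  also have "\<dots> = - D x y z w"
    using a[of x y w z] skew[of x y w z] by simp
  finally show ?thesis by simp
qed

text \<open>The symmetric form of \<open>A\<close> under the identification of the complexified
  sp(2) with quadratic forms on \<open>W\<close>.\<close>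

definition quad_form :: "('v \<Rightarrow>\<^sub>L 'v) \<Rightarrow> 'v \<Rightarrow> 'v \<Rightarrow> complex" where
  "quad_form A x y = Complex (A x \<bullet> J2 y) (A x \<bullet> J3 y)"

definition symp_form :: "'v \<Rightarrow> 'v \<Rightarrow> complex" where
  "symp_form x y = Complex (x \<bullet> J2 y) (x \<bullet> J3 y)"

lemma sp2_wedge_inner:
  "sp2_wedge z w x \<bullet> y =
     (x \<bullet> z) * (y \<bullet> w) - (x \<bullet> w) * (y \<bullet> z) + (x \<bullet> J1 z) * (y \<bullet> J1 w) - (x \<bullet> J1 w) * (y \<bullet> J1 z)
   + (x \<bullet> J2 z) * (y \<bullet> J2 w) - (x \<bullet> J2 w) * (y \<bullet> J2 z)
   + (x \<bullet> J3 z) * (y \<bullet> J3 w) - (x \<bullet> J3 w) * (y \<bullet> J3 z)"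
  by (simp add: sp2_wedge_apply inner_diff_left inner_left_distrib J_inner_swap[of x]
      inner_commute[of x] inner_commute[of y])

lemma S_cpx_sp2_wedge:
  "S_cpx (\<lambda>x y z w. sp2_wedge z w x \<bullet> y) x y z w = 2 * (symp_form x z * symp_form y w + symp_form x w * symp_form y z)"
  by (intro complex_eqI) (simp_all add: S_cpx_def symp_form_def sp2_wedge_inner algebra_simps)

text \<open>The coefficients come from \<open>curv_op_sp2_wedge\<close>: with the operator equal to
  5 P - 3/2 and the factor 8 of \<open>frob_sp2_wedge\<close>, 4 K is 40 times the sum minus 3/2
  times the wedge.\<close>

definition frob_form :: "('v \<Rightarrow>\<^sub>L 'v) set \<Rightarrow> 'v \<Rightarrow> 'v \<Rightarrow> 'v \<Rightarrow> 'v \<Rightarrow> real" where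
  "frob_form S x y z w =
     10 * (\<Sum>A\<in>S. (blinfun_apply A x \<bullet> y) * (blinfun_apply A z \<bullet> w)) - 3/8 * (sp2_wedge z w x \<bullet> y)"

text \<open>The correction is a product of symplectic forms, so it vanishes when all four arguments
  agree and the quartic form is a sum of squares.\<close>

lemma S_cpx_frob_form:
  "S_cpx (frob_form S) x y z w = 10 * (\<Sum>A\<in>S. quad_form A x y * quad_form A z w)
     - 3/4 * (symp_form x z * symp_form y w + symp_form x w * symp_form y z)"
proof -
  have "S_cpx (frob_form S) x y z w = 10 * (\<Sum>A\<in>S. quad_form A x y * quad_form A z w)
     - 3/8 * S_cpx (\<lambda>x y z w. sp2_wedge z w x \<bullet> y) x y z w"
    by (intro complex_eqI)
      (simp_all add: S_cpx_def frob_form_def quad_form_def sum_subtractf sum.distrib algebra_simps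
        add_divide_distrib diff_divide_distrib)
  then show ?thesis unfolding S_cpx_sp2_wedge by simp
qed

lemma quad_form_add: "quad_form A (x + x') y = quad_form A x y + quad_form A x' y"
  by (simp add: quad_form_def inner_left_distrib complex_eq_iff)

lemma symp_form_add: "symp_form (x + x') y = symp_form x y + symp_form x' y" "symp_form y (x + x') = symp_form y x + symp_form y x'"
  by (simp_all add: symp_form_def inner_left_distrib inner_right_distrib complex_eq_iff)

lemma symp_form_J1_scale: "symp_form (J1_scale c x) y = c * symp_form x y" "symp_form y (J1_scale c x) = c * symp_form y x"
  by (simp_all add: symp_form_def J1_scale_def inner_left_distrib inner_right_distrib inner_diff_right complex_eq_iff)

lemma quad_form_sym: "quad_form A y x = quad_form A x y" if "A \<in> sp"
proof -
  have "A y \<bullet> J2 x = A x \<bullet> J2 y" "A y \<bullet> J3 x = A x \<bullet> J3 y"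
    by (simp_all only: sp2D(1)[OF that, of y] sp2D(2-4)[OF that] J_inner_swap[of y] minus_minus)
  then show ?thesis by (simp add: quad_form_def)
qed

lemma quad_form_J1_scale: "quad_form A (J1_scale c x) y = c * quad_form A x y" if "A \<in> sp"
  by (simp add: quad_form_def J1_scale_def inner_left_distrib sp2D[OF that] complex_eq_iff)

definition frame_comb :: "'v \<Rightarrow> 'v \<Rightarrow> complex \<Rightarrow> complex \<Rightarrow> complex \<Rightarrow> complex \<Rightarrow> 'v" where
  "frame_comb u v x1 x2 x3 x4 = J1_scale x1 u + J1_scale x2 v + J1_scale x3 (J2 u) + J1_scale x4 (J2 v)"

lemma frame_comb_surj:
  assumes "DIM('v) = 8" "frame u v"
  obtains x1 x2 x3 x4 where "x = frame_comb u v x1 x2 x3 x4"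
proof
  show "x = frame_comb u v (Complex (x \<bullet> u) (x \<bullet> J1 u)) (Complex (x \<bullet> v) (x \<bullet> J1 v))
      (Complex (x \<bullet> J2 u) (x \<bullet> J3 u)) (Complex (x \<bullet> J2 v) (x \<bullet> J3 v))"
    using frame_expand[OF assms, of x]
    by (simp add: frame_comb_def J1_scale_def line_part_def algebra_simps)
qed

lemma symp_form_frame_comb:
  assumes "frame u v"
  shows "symp_form (frame_comb u v x1 x2 x3 x4) (frame_comb u v y1 y2 y3 y4) = x3 * y1 - x1 * y3 + x4 * y2 - x2 * y4"
proof -
  note [simp] = frame_inner[OF assms]
  have [simp]: "Complex 0 0 = 0" "Complex 1 0 = 1" "Complex (-1) 0 = -1" 
    by (simp_all add: complex_eq_iff)
  have s: "symp_form u u = 0" "symp_form u v = 0" "symp_form v u = 0" "symp_form v v = 0"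
    "symp_form u (J2 u) = -1" "symp_form u (J2 v) = 0" "symp_form v (J2 u) = 0" "symp_form v (J2 v) = -1"
    "symp_form (J2 u) u = 1" "symp_form (J2 u) v = 0" "symp_form (J2 v) u = 0" "symp_form (J2 v) v = 1"
    "symp_form (J2 u) (J2 u) = 0" "symp_form (J2 u) (J2 v) = 0" "symp_form (J2 v) (J2 u) = 0" "symp_form (J2 v) (J2 v) = 0"
    by (simp_all add: symp_form_def)
  show ?thesis
    unfolding frame_comb_def by (simp add: symp_form_add symp_form_J1_scale s)
qed

text \<open>The ten real coordinates of \<open>A\<close> become the coefficients of a quadratic form
  on \<open>W\<close>. Since \<open>A\<close> commutes with \<open>J2\<close>, the coefficients
  belonging to \<open>J2 u\<close>, \<open>J2 v\<close> are conjugates, up to sign, of the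
  others.\<close>

lemma quad_form_frame_comb:
  assumes A: "A \<in> sp"
  shows "quad_form A (frame_comb u v x1 x2 x3 x4) (frame_comb u v y1 y2 y3 y4) =
     Complex (A u \<bullet> J2 u) (A u \<bullet> J3 u) * (x1 * y1) + Complex (A v \<bullet> J2 v) (A v \<bullet> J3 v) * (x2 * y2)
   + Complex (A u \<bullet> J2 u) (- (A u \<bullet> J3 u)) * (x3 * y3)
   + Complex (A v \<bullet> J2 v) (- (A v \<bullet> J3 v)) * (x4 * y4)
   + Complex (A u \<bullet> J2 v) (A u \<bullet> J3 v) * (x1 * y2 + x2 * y1)
   + Complex (A u \<bullet> J2 v) (- (A u \<bullet> J3 v)) * (x3 * y4 + x4 * y3)
   - \<i> * of_real (A u \<bullet> J1 u) * (x1 * y3 + x3 * y1) - \<i> * of_real (A v \<bullet> J1 v) * (x2 * y4 + x4 * y2)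
   - Complex (A u \<bullet> v) (A u \<bullet> J1 v) * (x1 * y4 + x4 * y1)
   + Complex (A u \<bullet> v) (- (A u \<bullet> J1 v)) * (x2 * y3 + x3 * y2)"
proof -
  have add2: "quad_form A y (x + x') = quad_form A y x + quad_form A y x'" for x x' y
    by (metis quad_form_add quad_form_sym[OF A])
  have cs2: "quad_form A y (J1_scale c x) = c * quad_form A y x" for c x y
    by (metis quad_form_J1_scale[OF A] quad_form_sym[OF A])
  have vu: "A v \<bullet> u = - (A u \<bullet> v)" "A v \<bullet> J1 u = A u \<bullet> J1 v"
    by (rule sp2_frame_swap[OF A])+
  have d: "quad_form A u (J2 u) = - \<i> * of_real (A u \<bullet> J1 u)" "quad_form A v (J2 v) = - \<i> * of_real (A v \<bullet> J1 v)"
    "quad_form A u (J2 v) = - Complex (A u \<bullet> v) (A u \<bullet> J1 v)"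
    "quad_form A v (J2 u) = Complex (A u \<bullet> v) (- (A u \<bullet> J1 v))"
    "quad_form A (J2 u) (J2 u) = Complex (A u \<bullet> J2 u) (- (A u \<bullet> J3 u))"
    "quad_form A (J2 v) (J2 v) = Complex (A v \<bullet> J2 v) (- (A v \<bullet> J3 v))"
    "quad_form A (J2 u) (J2 v) = Complex (A u \<bullet> J2 v) (- (A u \<bullet> J3 v))"
    "quad_form A u u = Complex (A u \<bullet> J2 u) (A u \<bullet> J3 u)" "quad_form A v v = Complex (A v \<bullet> J2 v) (A v \<bullet> J3 v)"
    "quad_form A u v = Complex (A u \<bullet> J2 v) (A u \<bullet> J3 v)"
    using A by (simp_all add: quad_form_def vu complex_eq_iff sp2D(2-4)[OF A])
  have s: "quad_form A v u = quad_form A u v" "quad_form A (J2 u) x = quad_form A x (J2 u)" "quad_form A (J2 v) x = quad_form A x (J2 v)" for x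
    using quad_form_sym[OF A] by auto
  show ?thesis
    unfolding frame_comb_def quad_form_add add2 cs2 quad_form_J1_scale[OF A]
      s(1) s(2)[of u] s(2)[of v] s(3)[of u] s(3)[of v] s(3)[of "J2 u"] d
    by (simp add: algebra_simps)
qed

section \<open>Adapted bases\<close>

lemma cscale_to_W: "c *\<^sub>C to_W x = to_W (J1_scale c x)"
  by (simp add: cscale_def to_W_def J1_scale_def)

lemma to_W_add: "to_W x + to_W y = to_W (x + y)"
  by (simp add: to_W_def)

lemma to_W_eq_iff: "to_W x = to_W y \<longleftrightarrow> x = y"
  by (auto simp: to_W_def)

lemma to_W_in_W: "to_W x \<in> W_space J1"
  by (simp add: W_space_def to_W_def cmap_def cscale_def)

lemma W_spaceE:
  assumes "z \<in> W_space J1"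
  obtains x where "z = to_W x"
proof
  show "z = to_W (fst z)"
    using assms by (cases z) (auto simp: W_space_def to_W_def cmap_def cscale_def)
qed

lemma cmap_J2_cconj_to_W: "cmap J2 (cconj (to_W x)) = to_W (J2 x)"
  by (simp add: cmap_def cconj_def to_W_def)

lemma cext2_pi_form_to_W: "cext2 (pi_form J2) (to_W x) (to_W y) = - 2 * symp_form x y"
  by (simp add: cext2_def cext1_def pi_form_def to_W_def symp_form_def complex_eq_iff)

lemma J1_scale_simps [simp]: "J1_scale 0 x = 0" "J1_scale 1 x = x" "J1_scale c 0 = 0"
  by (simp_all add: J1_scale_def)

lemma J1_scale_scaleR: "J1_scale c (r *\<^sub>R x) = r *\<^sub>R J1_scale c x"
  by (simp add: J1_scale_def algebra_simps)

lemma frame_comb_scaleR: "frame_comb (r *\<^sub>R u) (r *\<^sub>R v) x1 x2 x3 x4 = r *\<^sub>R frame_comb u v x1 x2 x3 x4"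
  by (simp add: frame_comb_def J1_scale_scaleR algebra_simps)

lemma adapted_sum:
  fixes e :: "nat \<Rightarrow> 'v complexified"
  assumes "e 1 = to_W a" "e 2 = to_W b" "e 3 = to_W (J2 a)" "e 4 = to_W (J2 b)"
  shows "(\<Sum>\<alpha>=1..4. x \<alpha> *\<^sub>C e \<alpha>) = to_W (frame_comb a b (x 1) (x 2) (x 3) (x 4))"
  unfolding sum_1_4 assms cscale_to_W to_W_add frame_comb_def ..

text \<open>The values of the 2-form on pairs of basis vectors determine all quaternionic inner
  products of \<open>a\<close> and \<open>b\<close>. Its extension is
  \<open>- 2 * symp_form\<close>, so these vectors have squared length 1/2.\<close>

lemma sp2_adapted_imp_frame:
  assumes "sp2_adapted J1 J2 e"
  obtains a b where "e 1 = to_W a" "e 2 = to_W b" "e 3 = to_W (J2 a)" "e 4 = to_W (J2 b)"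
    "frame (sqrt 2 *\<^sub>R a) (sqrt 2 *\<^sub>R b)"
proof -
  note ad = assms[unfolded sp2_adapted_def]
  have "e 1 \<in> W_space J1" "e 2 \<in> W_space J1"
    using ad cV.span_superset[of "e ` {1..4}"] by auto
  then obtain a b where ab: "e 1 = to_W a" "e 2 = to_W b"
    by (metis W_spaceE)
  then have e34: "e 3 = to_W (J2 a)" "e 4 = to_W (J2 b)"
    using ad by (simp_all add: cmap_J2_cconj_to_W)
  have p: "- 2 * symp_form (frame_comb a b x1 x2 x3 x4) (frame_comb a b y1 y2 y3 y4) =
      (x1 * y3 - y1 * x3) + (x2 * y4 - y2 * x4)" for x1 x2 x3 x4 y1 y2 y3 y4
  proof -
    have *: "\<forall>x y :: nat \<Rightarrow> complex.
        cext2 (pi_form J2) (\<Sum>\<alpha>=1..4. x \<alpha> *\<^sub>C e \<alpha>) (\<Sum>\<alpha>=1..4. y \<alpha> *\<^sub>C e \<alpha>) =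
        (x 1 * y 3 - y 1 * x 3) + (x 2 * y 4 - y 2 * x 4)"
      using ad by blast
    show ?thesis
      using *[rule_format, of "\<lambda>\<alpha>. if \<alpha> = 1 then x1 else if \<alpha> = 2 then x2 else if \<alpha> = 3 then x3 else x4"
          "\<lambda>\<alpha>. if \<alpha> = 1 then y1 else if \<alpha> = 2 then y2 else if \<alpha> = 3 then y3 else y4"]
      unfolding adapted_sum[OF ab e34] cext2_pi_form_to_W by simp
  qed
  have "a \<bullet> a = 1/2" "b \<bullet> b = 1/2" "a \<bullet> b = 0" "a \<bullet> J1 b = 0" "a \<bullet> J2 b = 0" "a \<bullet> J3 b = 0"
    using p[of 1 0 0 0 0 0 1 0] p[of 0 1 0 0 0 0 0 1] p[of 1 0 0 0 0 1 0 0] p[of 1 0 0 0 0 0 0 1]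
    by (simp_all add: frame_comb_def symp_form_def complex_eq_iff)
  then have "frame (sqrt 2 *\<^sub>R a) (sqrt 2 *\<^sub>R b)"
    by (simp add: frame_def flip: mult.assoc)
  then show ?thesis using that ab e34 by blast
qed

text \<open>Pairing with the basis vectors under the symplectic form reads off coordinates, which
  gives distinctness and independence; the frame expansion gives spanning.\<close>

lemma frame_imp_sp2_adapted:
  assumes dim: "DIM('v) = 8" and fr: "frame (sqrt 2 *\<^sub>R a) (sqrt 2 *\<^sub>R b)"
    and e: "e 1 = to_W a" "e 2 = to_W b" "e 3 = to_W (J2 a)" "e 4 = to_W (J2 b)"
  shows "sp2_adapted J1 J2 e"
proof -
  let ?u = "sqrt 2 *\<^sub>R a" and ?v = "sqrt 2 *\<^sub>R b"
  have set4: "{1..4::nat} = {1, 2, 3, 4}" by auto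
  have p: "2 * symp_form (frame_comb a b x1 x2 x3 x4) (frame_comb a b y1 y2 y3 y4) = x3 * y1 - x1 * y3 + x4 * y2 - x2 * y4"
    for x1 x2 x3 x4 y1 y2 y3 y4
  proof -
    have s: "symp_form (sqrt 2 *\<^sub>R x) (sqrt 2 *\<^sub>R y) = 2 * symp_form x y" for x y
      by (simp add: symp_form_def complex_eq_iff)
    show ?thesis using symp_form_frame_comb[OF fr, of x1 x2 x3 x4 y1 y2 y3 y4] by (simp add: frame_comb_scaleR s)
  qed
  have zero: "x1 = 0 \<and> x2 = 0 \<and> x3 = 0 \<and> x4 = 0" if "frame_comb a b x1 x2 x3 x4 = 0" for x1 x2 x3 x4
    using p[of x1 x2 x3 x4 1 0 0 0] p[of x1 x2 x3 x4 0 1 0 0] p[of x1 x2 x3 x4 0 0 1 0]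
      p[of x1 x2 x3 x4 0 0 0 1]
    by (simp add: that symp_form_def complex_eq_iff)
  have ne: "x \<noteq> y" if "symp_form x z = 0" "symp_form y z \<noteq> 0" for x y z
    using that by auto
  have c: "frame_comb a b 1 0 0 0 = a" "frame_comb a b 0 1 0 0 = b" "frame_comb a b 0 0 1 0 = J2 a" "frame_comb a b 0 0 0 1 = J2 b"
    by (simp_all add: frame_comb_def)
  have d: "a \<noteq> b" "a \<noteq> J2 a" "a \<noteq> J2 b" "b \<noteq> J2 a" "b \<noteq> J2 b" "J2 a \<noteq> J2 b"
    using p[of 1 0 0 0 0 0 1 0, unfolded c] p[of 0 1 0 0 0 0 1 0, unfolded c] p[of 0 0 1 0 0 0 1 0, unfolded c]
      p[of 0 0 0 1 0 0 1 0, unfolded c] p[of 0 1 0 0 0 0 0 1, unfolded c] p[of 0 0 1 0 0 0 0 1, unfolded c]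
      p[of 0 0 0 1 0 0 0 1, unfolded c] p[of 0 0 1 0 1 0 0 0, unfolded c] p[of 0 0 0 1 1 0 0 0, unfolded c]
    by auto
  have inj: "inj_on e {1..4}"
    unfolding set4 using d by (auto simp: inj_on_def e e[unfolded One_nat_def] to_W_eq_iff)
  have indep: "cV.independent (e ` {1..4})"
  proof (rule cV.independent_if_scalars_zero)
    fix f x assume f: "(\<Sum>x\<in>e ` {1..4}. f x *\<^sub>C x) = 0" and x: "x \<in> e ` {1..4}"
    have "(\<Sum>x\<in>e ` {1..4}. f x *\<^sub>C x) = (\<Sum>\<alpha>=1..4. f (e \<alpha>) *\<^sub>C e \<alpha>)"
      by (subst sum.reindex[OF inj]) simp
    then have "to_W (frame_comb a b (f (e 1)) (f (e 2)) (f (e 3)) (f (e 4))) = 0"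
      using f adapted_sum[OF e, of "\<lambda>\<alpha>. f (e \<alpha>)"] by simp
    then have "frame_comb a b (f (e 1)) (f (e 2)) (f (e 3)) (f (e 4)) = 0"
      by (simp add: to_W_def prod_eq_iff)
    from zero[OF this] show "f x = 0" using x unfolding set4 by auto
  qed simp
  have "cV.span (e ` {1..4}) = W_space J1"
  proof
    have "cV.subspace (W_space J1)"
      by (rule cV.subspaceI)
        (auto simp: W_space_def cmap_def cscale_def algebra_simps)
    moreover have "e ` {1..4} \<subseteq> W_space J1"
      unfolding set4 by (auto simp: e e[unfolded One_nat_def] to_W_in_W)
    ultimately show "cV.span (e ` {1..4}) \<subseteq> W_space J1"
      by (intro cV.span_minimal)
    show "W_space J1 \<subseteq> cV.span (e ` {1..4})"
    proof
      fix z assume "z \<in> W_space J1"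
      then obtain x where z: "z = to_W x" by (rule W_spaceE)
      obtain x1 x2 x3 x4 where x: "sqrt 2 *\<^sub>R x = frame_comb ?u ?v x1 x2 x3 x4"
        using frame_comb_surj[OF dim fr] by blast
      then have x: "x = frame_comb a b x1 x2 x3 x4"
        by (simp add: frame_comb_scaleR)
      let ?x = "\<lambda>\<alpha>::nat. if \<alpha> = 1 then x1 else if \<alpha> = 2 then x2 else if \<alpha> = 3 then x3 else x4"
      have "z = (\<Sum>\<alpha>=1..4. ?x \<alpha> *\<^sub>C e \<alpha>)"
        unfolding adapted_sum[OF e] by (simp add: z x)
      also have "\<dots> \<in> cV.span (e ` {1..4})"
        by (intro cV.span_sum cV.span_scale cV.span_base imageI)
      finally show "z \<in> cV.span (e ` {1..4})" .
    qed
  qed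
  moreover have "cext2 (pi_form J2) (\<Sum>\<alpha>=1..4. x \<alpha> *\<^sub>C e \<alpha>) (\<Sum>\<alpha>=1..4. y \<alpha> *\<^sub>C e \<alpha>) =
        (x 1 * y 3 - y 1 * x 3) + (x 2 * y 4 - y 2 * x 4)" for x y :: "nat \<Rightarrow> complex"
    unfolding adapted_sum[OF e] cext2_pi_form_to_W
    using p[of "x 1" "x 2" "x 3" "x 4" "y 1" "y 2" "y 3" "y 4"] by (simp add: algebra_simps)
  ultimately show ?thesis
    using inj indep unfolding sp2_adapted_def by (simp add: e cmap_J2_cconj_to_W del: One_nat_def)
qed

text \<open>Rescaling by \<open>sqrt 2\<close> multiplies a quartic form by 4, which absorbs the
  factor 4 of \<open>cext4_S_tensor\<close>; the coefficients of the quartic stay the same.\<close>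

lemma discr_curv_iff:
  assumes dim: "DIM('v) = 8" and K: "K \<in> curv_sp2 J1 J2 J3"
  shows "K \<in> discr_curv J1 J2 J3 \<longleftrightarrow>
    (\<exists>u v. frame u v \<and> (\<forall>x1 x2 x3 x4. let X = frame_comb u v x1 x2 x3 x4 in
       S_cpx K X X X X = discr_quartic x1 x2 x3 x4))"
    (is "_ \<longleftrightarrow> ?R")
proof -
  have sc: "S_cpx K (sqrt 2 *\<^sub>R x) (sqrt 2 *\<^sub>R x) (sqrt 2 *\<^sub>R x) (sqrt 2 *\<^sub>R x) = 4 * S_cpx K x x x x" for x
  proof -
    have s: "sqrt 2 * (sqrt 2 * t) = 2 * t" for t by (simp flip: mult.assoc)
    show ?thesis
      by (simp add: s S_cpx_def curv_scale[OF K] complex_eq_iff algebra_simps)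
  qed
  have key: "cext4 (S_tensor J2 J3 K) (to_W x) (to_W x) (to_W x) (to_W x) =
      S_cpx K (sqrt 2 *\<^sub>R x) (sqrt 2 *\<^sub>R x) (sqrt 2 *\<^sub>R x) (sqrt 2 *\<^sub>R x)" for x
    unfolding cext4_S_tensor[OF K] sc ..
  show ?thesis
  proof
    assume "K \<in> discr_curv J1 J2 J3"
    then obtain e where ad: "sp2_adapted J1 J2 e"
      and q: "\<And>x. let X = (\<Sum>\<alpha>=1..4. x \<alpha> *\<^sub>C e \<alpha>) in
          cext4 (S_tensor J2 J3 K) X X X X = discr_quartic (x 1) (x 2) (x 3) (x 4)"
      unfolding discr_curv_def discr_quartic_def by blast
    obtain a b where e: "e 1 = to_W a" "e 2 = to_W b" "e 3 = to_W (J2 a)" "e 4 = to_W (J2 b)"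
      and fr: "frame (sqrt 2 *\<^sub>R a) (sqrt 2 *\<^sub>R b)"
      using sp2_adapted_imp_frame[OF ad] by blast
    have "let X = frame_comb (sqrt 2 *\<^sub>R a) (sqrt 2 *\<^sub>R b) x1 x2 x3 x4 in
       S_cpx K X X X X = discr_quartic x1 x2 x3 x4" for x1 x2 x3 x4
      using q[of "\<lambda>\<alpha>. if \<alpha> = 1 then x1 else if \<alpha> = 2 then x2 else if \<alpha> = 3 then x3 else x4"]
      unfolding adapted_sum[OF e] Let_def key frame_comb_scaleR by simp
    with fr show ?R by blast
  next
    assume ?R
    then obtain u v where fr: "frame u v"
      and q: "\<And>x1 x2 x3 x4. let X = frame_comb u v x1 x2 x3 x4 in
       S_cpx K X X X X = discr_quartic x1 x2 x3 x4" by blast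
    define a b where "a = (1 / sqrt 2) *\<^sub>R u" and "b = (1 / sqrt 2) *\<^sub>R v"
    have uv: "u = sqrt 2 *\<^sub>R a" "v = sqrt 2 *\<^sub>R b" by (simp_all add: a_def b_def)
    define e where "e \<alpha> = (if \<alpha> = 1 then to_W a else if \<alpha> = 2 then to_W b
      else if \<alpha> = 3 then to_W (J2 a) else to_W (J2 b))" for \<alpha> :: nat
    have e: "e 1 = to_W a" "e 2 = to_W b" "e 3 = to_W (J2 a)" "e 4 = to_W (J2 b)"
      by (simp_all add: e_def)
    have "sp2_adapted J1 J2 e"
      by (rule frame_imp_sp2_adapted[OF dim fr[unfolded uv] e])
    moreover have "let X = (\<Sum>\<alpha>=1..4. x \<alpha> *\<^sub>C e \<alpha>) in
          cext4 (S_tensor J2 J3 K) X X X X = discr_quartic (x 1) (x 2) (x 3) (x 4)" for x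
      using q[of "x 1" "x 2" "x 3" "x 4"]
      unfolding adapted_sum[OF e] Let_def key uv frame_comb_scaleR .
    ultimately show "K \<in> discr_curv J1 J2 J3"
      using K unfolding discr_curv_def discr_quartic_def by blast
  qed
qed

section \<open>Discriminant tensors satisfy the two conditions\<close>

lemma frob_form_skew:
  assumes "S \<subseteq> sp"
  shows "frob_form S x y w z = - frob_form S x y z w"
    "frob_form S x y (J1 z) w = - frob_form S x y z (J1 w)"
proof -
  have e: "A \<in> sp" if "A \<in> S" for A using assms that by auto
  have "(\<Sum>A\<in>S. (blinfun_apply A x \<bullet> y) * (blinfun_apply A w \<bullet> z)) = - (\<Sum>A\<in>S. (blinfun_apply A x \<bullet> y) * (blinfun_apply A z \<bullet> w))"
    unfolding sum_negf[symmetric]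
    by (intro sum.cong refl) (simp add: sp2D(1)[OF e, of _ w z] inner_commute[of w])
  moreover have "(\<Sum>A\<in>S. (blinfun_apply A x \<bullet> y) * (blinfun_apply A (J1 z) \<bullet> w)) = - (\<Sum>A\<in>S. (blinfun_apply A x \<bullet> y) * (blinfun_apply A z \<bullet> J1 w))"
    unfolding sum_negf[symmetric]
    by (intro sum.cong refl) (simp add: sp2D(2)[OF e])
  ultimately show "frob_form S x y w z = - frob_form S x y z w"
    "frob_form S x y (J1 z) w = - frob_form S x y z (J1 w)"
    by (simp_all add: frob_form_def sp2_wedge_inner algebra_simps)
qed

lemma curv_op_frob_form:
  fixes A :: "'v \<Rightarrow>\<^sub>L 'v"
  assumes K: "K \<in> curv_sp2 J1 J2 J3" and eq: "\<And>x y z w. K x y z w = frob_form S x y z w"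
    and A: "A \<in> sp"
  shows "curv_op K A = 5 *\<^sub>R (\<Sum>B\<in>S. frob A B *\<^sub>R B) - (3/2) *\<^sub>R A"
proof (rule blinfun_eqI)
  fix x
  have "curv_op K A x \<bullet> y = (5 *\<^sub>R (\<Sum>B\<in>S. frob A B *\<^sub>R B) - (3/2) *\<^sub>R A) x \<bullet> y" for y
  proof -
    have "curv_op K A x \<bullet> y =
        1/2 * (\<Sum>h\<in>Basis. 10 * (\<Sum>B\<in>S. (blinfun_apply B x \<bullet> y) * (blinfun_apply B h \<bullet> A h)) - 3/8 * (sp2_wedge h (A h) x \<bullet> y))"
      unfolding curv_op_Basis[OF K] eq frob_form_def ..
    also have "\<dots> = 5 * (\<Sum>h\<in>Basis. \<Sum>B\<in>S. (blinfun_apply B x \<bullet> y) * (blinfun_apply B h \<bullet> A h))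
        - 3/16 * (\<Sum>h\<in>Basis. sp2_wedge h (A h) x \<bullet> y)"
      by (simp add: sum_subtractf flip: sum_distrib_left sum_divide_distrib)
    also have "(\<Sum>h\<in>Basis. \<Sum>B\<in>S. (blinfun_apply B x \<bullet> y) * (blinfun_apply B h \<bullet> A h)) = (\<Sum>B\<in>S. (blinfun_apply B x \<bullet> y) * frob B A)"
      by (subst sum.swap) (simp add: frob_def sum_distrib_left)
    finally show ?thesis
      by (simp add: sum_sp2_wedge[OF A] blinfun.sum_left inner_diff_left inner_sum_left
          sum_distrib_left frob_commute[of A] mult.commute)
  qed
  then show "curv_op K A x = (5 *\<^sub>R (\<Sum>B\<in>S. frob A B *\<^sub>R B) - (3/2) *\<^sub>R A) x"
    by (meson vector_eq_rdot)
qed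

lemma sp2_wedge_frame:
  assumes "frame u v"
  shows "sp2_wedge u (J1 u) u = 2 *\<^sub>R J1 u" "sp2_wedge u (J2 u) u = 2 *\<^sub>R J2 u" "sp2_wedge u (J3 u) u = 2 *\<^sub>R J3 u"
    "sp2_wedge u (J1 u) v = 0" "sp2_wedge u (J2 u) v = 0" "sp2_wedge u (J3 u) v = 0"
    "sp2_wedge u v u = v" "sp2_wedge u v v = - u" "sp2_wedge u (J1 v) u = J1 v" "sp2_wedge u (J1 v) v = J1 u"
  using frame_inner[OF assms] by (simp_all add: sp2_wedge_apply scaleR_2)

definition frob_proj where
  "frob_proj A1 A2 A3 A = frob A A1 *\<^sub>R A1 + frob A A2 *\<^sub>R A2 + frob A A3 *\<^sub>R A3"

text \<open>Condition (I) is idempotence of the projection to the span of the triple. The two sides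
  of (II) differ by 25 ([P A, P B] - P [P A, B]), and this vanishes because \<open>ad\<close> of an
  element of the span preserves the span and, by invariance of \<open>frob\<close>, its
  complement.\<close>

lemma orthonormal_triple_conditions:
  fixes A1 A2 A3 :: "'v \<Rightarrow>\<^sub>L 'v"
  assumes K: "K \<in> curv_sp2 J1 J2 J3"
    and T: "\<And>A. A \<in> sp \<Longrightarrow> curv_op K A = 5 *\<^sub>R frob_proj A1 A2 A3 A - (3/2) *\<^sub>R A"
    and sp: "A1 \<in> sp" "A2 \<in> sp" "A3 \<in> sp"
    and on: "frob A1 A1 = 1" "frob A2 A2 = 1" "frob A3 A3 = 1"
      "frob A1 A2 = 0" "frob A1 A3 = 0" "frob A2 A3 = 0"
    and br: "bracket A1 A2 = \<nu> *\<^sub>R A3" "bracket A2 A3 = \<nu> *\<^sub>R A1" "bracket A3 A1 = \<nu> *\<^sub>R A2"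
  shows "A \<in> sp \<Longrightarrow> let B = 2 *\<^sub>R curv_op K A + 3 *\<^sub>R A in 2 *\<^sub>R curv_op K B - 7 *\<^sub>R B = 0"
    and "A \<in> sp \<Longrightarrow> B \<in> sp \<Longrightarrow>
      bracket (curv_op K A) (curv_op K B) - curv_op K (bracket (curv_op K A) B) =
       (3/2) *\<^sub>R (curv_op K (bracket A B) - bracket A (curv_op K B))"
proof -
  let ?P = "frob_proj A1 A2 A3"
  have on': "frob A2 A1 = 0" "frob A3 A1 = 0" "frob A3 A2 = 0"
    using on by (simp_all add: frob_commute)
  have P_sp: "?P A \<in> sp" for A
    by (simp add: frob_proj_def sp2_closed sp)
  have P_lin: "?P (A + B) = ?P A + ?P B" "?P (A - B) = ?P A - ?P B" "?P (r *\<^sub>R A) = r *\<^sub>R ?P A" for A B r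
    by (simp_all add: frob_proj_def frob_bilinear algebra_simps)
  have P_P: "?P (?P A) = ?P A" for A
    by (simp add: frob_proj_def frob_bilinear on on')
  show "let B = 2 *\<^sub>R curv_op K A + 3 *\<^sub>R A in 2 *\<^sub>R curv_op K B - 7 *\<^sub>R B = 0" if A: "A \<in> sp"
  proof -
    have "2 *\<^sub>R curv_op K A + 3 *\<^sub>R A = 10 *\<^sub>R ?P A"
      by (simp add: T[OF A] algebra_simps)
    moreover have "2 *\<^sub>R curv_op K (10 *\<^sub>R ?P A) - 7 *\<^sub>R (10 *\<^sub>R ?P A) = 0"
      by (simp add: T sp2_closed P_sp P_lin P_P algebra_simps flip: scaleR_add_left)
    ultimately show ?thesis by (simp add: Let_def)
  qed
  show "bracket (curv_op K A) (curv_op K B) - curv_op K (bracket (curv_op K A) B) =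
       (3/2) *\<^sub>R (curv_op K (bracket A B) - bracket A (curv_op K B))"
    if A: "A \<in> sp" and B: "B \<in> sp"
  proof -
    have br': "bracket A2 A1 = - \<nu> *\<^sub>R A3" "bracket A3 A2 = - \<nu> *\<^sub>R A1" "bracket A1 A3 = - \<nu> *\<^sub>R A2"
      using br bracket_commute[of A2 A1] bracket_commute[of A3 A2] bracket_commute[of A1 A3] by simp_all
    have sk: "X x \<bullet> y = - (x \<bullet> X y)" if "X \<in> sp" for X :: "'v \<Rightarrow>\<^sub>L 'v" and x y
      by (rule sp2D(1)[OF that])
    have f: "frob (bracket X B) Y = - frob B (bracket X Y)" if "X \<in> sp" for X Y
      by (rule frob_bracket[OF sk[OF that] sk[OF B]])
    have PB: "bracket (?P A) (?P B) = ?P (bracket (?P A) B)"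
      by (simp add: frob_proj_def bracket_bilinear frob_bilinear f sp br br')
        (simp add: algebra_simps)
    have "bracket (curv_op K A) (curv_op K B) - curv_op K (bracket (curv_op K A) B)
         - (3/2) *\<^sub>R (curv_op K (bracket A B) - bracket A (curv_op K B)) =
        25 *\<^sub>R (bracket (?P A) (?P B) - ?P (bracket (?P A) B))"
      by (simp add: T A B sp2_closed P_sp bracket_bilinear P_lin scaleR_diff_right scaleR_add_right)
    then show ?thesis unfolding PB by simp
  qed
qed

text \<open>
  \<open>H, X, Y\<close> below are an orthonormal basis of the principal \<open>su(2)\<close>; in the coordinates of the
  frame, the quadratic forms of \<open>X \<plusminus> iY\<close> are multiples of \<open>x\<^sub>2\<^sup>2 + sqrt 3 x\<^sub>1x\<^sub>4\<close> and \<open>x\<^sub>4\<^sup>2 - sqrt 3 x\<^sub>2x\<^sub>3\<close>.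
\<close>

lemma discr_curv_imp_conditions:
  assumes dim: "DIM('v) = 8" and K: "K \<in> curv_sp2 J1 J2 J3" and discr: "K \<in> discr_curv J1 J2 J3"
  shows "A \<in> sp \<Longrightarrow> let B = 2 *\<^sub>R curv_op K A + 3 *\<^sub>R A in 2 *\<^sub>R curv_op K B - 7 *\<^sub>R B = 0"
    and "A \<in> sp \<Longrightarrow> B \<in> sp \<Longrightarrow>
      bracket (curv_op K A) (curv_op K B) - curv_op K (bracket (curv_op K A) B) =
       (3/2) *\<^sub>R (curv_op K (bracket A B) - bracket A (curv_op K B))"
proof -
  obtain u v where fr: "frame u v"
    and quart: "\<And>x1 x2 x3 x4. let X = frame_comb u v x1 x2 x3 x4 in S_cpx K X X X X = discr_quartic x1 x2 x3 x4"
    using discr discr_curv_iff[OF dim K] by blast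
  \<comment> \<open>With weights \<open>3 * c\<close> and \<open>c\<close> the squared norm of
    \<open>H\<close> is \<open>40 * c^2\<close>. The choice of \<open>d\<close> below makes
    \<open>X\<close> and \<open>Y\<close> unit and lets the brackets close.\<close>
  define c where "c = 1 / sqrt 40"
  define d where "d = sqrt 3 * c"
  have c2: "c * c = 1/40" and d2: "d * d = 3/40" and dc: "d = sqrt 3 * c"
    by (simp_all add: c_def d_def)
  define H where "H = (3 * c / 2) *\<^sub>R sp2_wedge u (J1 u) + (c / 2) *\<^sub>R sp2_wedge v (J1 v)"
  define X where "X = c *\<^sub>R sp2_wedge v (J2 v) - d *\<^sub>R sp2_wedge u v"
  define Y where "Y = c *\<^sub>R sp2_wedge v (J3 v) - d *\<^sub>R sp2_wedge u (J1 v)"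
  have sp: "H \<in> sp" "X \<in> sp" "Y \<in> sp"
    by (simp_all add: H_def X_def Y_def sp2_closed sp2_wedge_in_sp2)
  have val: "H u = (3 * c) *\<^sub>R J1 u" "H v = c *\<^sub>R J1 v"
    "X u = - d *\<^sub>R v" "X v = (2 * c) *\<^sub>R J2 v + d *\<^sub>R u"
    "Y u = - d *\<^sub>R J1 v" "Y v = (2 * c) *\<^sub>R J3 v - d *\<^sub>R J1 u"
    by (simp_all add: H_def X_def Y_def sp2_wedge_frame[OF fr] sp2_wedge_frame[OF frame_sym[OF fr]])
  note fi = frame_inner[OF fr]
  have val': "H (J1 x) = J1 (H x)" "H (J2 x) = J2 (H x)" "H (J3 x) = J3 (H x)"
    "X (J1 x) = J1 (X x)" "X (J2 x) = J2 (X x)" "X (J3 x) = J3 (X x)"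
    "Y (J1 x) = J1 (Y x)" "Y (J2 x) = J2 (Y x)" "Y (J3 x) = J3 (Y x)" for x
    using sp by (simp_all add: sp2D)
  have frob: "frob A B = 4 * (A u \<bullet> B u + A v \<bullet> B v)" if "A \<in> sp" "B \<in> sp" for A B
    by (rule frob_frame[OF dim fr that])
  have on: "frob H H = 1" "frob X X = 1" "frob Y Y = 1" "frob H X = 0" "frob H Y = 0" "frob X Y = 0"
    using c2 d2
    by (simp_all add: frob sp val fi inner_left_distrib inner_right_distrib inner_diff_left inner_diff_right)
  have dd: "d * d = c * (c * 3)" using c2 d2 by simp
  have n: "(a * (b * 2)) *\<^sub>R x = (a * b) *\<^sub>R x + (a * b) *\<^sub>R x"
    "(a * (b * 3)) *\<^sub>R x = (a * b) *\<^sub>R x + (a * b) *\<^sub>R x + (a * b) *\<^sub>R x"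
    "(a * (b * 4)) *\<^sub>R x = (a * b) *\<^sub>R x + (a * b) *\<^sub>R x + (a * b) *\<^sub>R x + (a * b) *\<^sub>R x"
    "(a * (b * 6)) *\<^sub>R x = (a * b) *\<^sub>R x + (a * b) *\<^sub>R x + (a * b) *\<^sub>R x
       + (a * b) *\<^sub>R x + (a * b) *\<^sub>R x + (a * b) *\<^sub>R x"
    for a b and x :: 'v
    by (simp_all flip: scaleR_add_left)
  have br: "bracket H X = (- 2 * c) *\<^sub>R Y" "bracket X Y = (- 2 * c) *\<^sub>R H" "bracket Y H = (- 2 * c) *\<^sub>R X"
    by (rule sp2_eqI[OF dim fr], simp_all add: sp2_closed sp bracket_apply val val' algebra_simps dd n)+
  define S where "S = {H, X, Y}"
  have ne: "H \<noteq> X" "H \<noteq> Y" "X \<noteq> Y" using on by auto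
  have sumS: "(\<Sum>A\<in>S. f A) = f H + f X + f Y" for f :: "_ \<Rightarrow> 'b::comm_monoid_add"
    using ne by (simp add: S_def add.assoc)
  have Ssp: "S \<subseteq> sp" using sp by (simp add: S_def)
  let ?G = "\<lambda>x y z w. S_cpx (frob_form S) x y z w"
  have G: "?G x y z w = 10 * (quad_form H x y * quad_form H z w + quad_form X x y * quad_form X z w + quad_form Y x y * quad_form Y z w)
     - 3/4 * (symp_form x z * symp_form y w + symp_form x w * symp_form y z)" for x y z w
    by (simp add: S_cpx_frob_form sumS)
  define s where "s = complex_of_real (sqrt 3)"
  have s2: "s * s = 3" by (simp add: s_def flip: of_real_mult)
  define cc where "cc = complex_of_real c"
  have cc2: "10 * (cc * cc) = 1/4" by (simp add: cc_def c2 flip: of_real_mult)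
  have qH: "quad_form H (frame_comb u v x1 x2 x3 x4) (frame_comb u v y1 y2 y3 y4) =
      cc * (- \<i> * (3 * (x1 * y3 + x3 * y1) + (x2 * y4 + x4 * y2)))" 
    and qX: "quad_form X (frame_comb u v x1 x2 x3 x4) (frame_comb u v y1 y2 y3 y4) =
      cc * (2 * x2 * y2 + 2 * x4 * y4 + s * (x1 * y4 + x4 * y1) - s * (x2 * y3 + x3 * y2))"
    and qY: "quad_form Y (frame_comb u v x1 x2 x3 x4) (frame_comb u v y1 y2 y3 y4) =
      cc * (\<i> * (2 * x2 * y2 - 2 * x4 * y4 + s * (x1 * y4 + x4 * y1) + s * (x2 * y3 + x3 * y2)))"
    for x1 x2 x3 x4 y1 y2 y3 y4
  proof -
    have C: "Complex 0 r = \<i> * of_real r" "Complex r 0 = of_real r" for r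
      by (simp_all add: complex_eq_iff)
    show "quad_form H (frame_comb u v x1 x2 x3 x4) (frame_comb u v y1 y2 y3 y4) =
      cc * (- \<i> * (3 * (x1 * y3 + x3 * y1) + (x2 * y4 + x4 * y2)))"
    "quad_form X (frame_comb u v x1 x2 x3 x4) (frame_comb u v y1 y2 y3 y4) =
      cc * (2 * x2 * y2 + 2 * x4 * y4 + s * (x1 * y4 + x4 * y1) - s * (x2 * y3 + x3 * y2))"
    "quad_form Y (frame_comb u v x1 x2 x3 x4) (frame_comb u v y1 y2 y3 y4) =
      cc * (\<i> * (2 * x2 * y2 - 2 * x4 * y4 + s * (x1 * y4 + x4 * y1) + s * (x2 * y3 + x3 * y2)))"
      unfolding quad_form_frame_comb[OF sp(1)] quad_form_frame_comb[OF sp(2)] quad_form_frame_comb[OF sp(3)]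
      by (simp_all add: val fi inner_left_distrib inner_diff_left C cc_def s_def dc algebra_simps)
  qed
  have Gc: "?G (frame_comb u v x1 x2 x3 x4) (frame_comb u v y1 y2 y3 y4) (frame_comb u v z1 z2 z3 z4) (frame_comb u v w1 w2 w3 w4) =
     1/4 * (- ((3 * (x1 * y3 + x3 * y1) + (x2 * y4 + x4 * y2)) * (3 * (z1 * w3 + z3 * w1) + (z2 * w4 + z4 * w2)))
      + (2 * x2 * y2 + 2 * x4 * y4 + s * (x1 * y4 + x4 * y1) - s * (x2 * y3 + x3 * y2))
       * (2 * z2 * w2 + 2 * z4 * w4 + s * (z1 * w4 + z4 * w1) - s * (z2 * w3 + z3 * w2))
      - (2 * x2 * y2 - 2 * x4 * y4 + s * (x1 * y4 + x4 * y1) + s * (x2 * y3 + x3 * y2))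
       * (2 * z2 * w2 - 2 * z4 * w4 + s * (z1 * w4 + z4 * w1) + s * (z2 * w3 + z3 * w2)))
    - 3/4 * ((x3 * z1 - x1 * z3 + x4 * z2 - x2 * z4) * (y3 * w1 - y1 * w3 + y4 * w2 - y2 * w4)
        + (x3 * w1 - x1 * w3 + x4 * w2 - x2 * w4) * (y3 * z1 - y1 * z3 + y4 * z2 - y2 * z4))"
    for x1 x2 x3 x4 y1 y2 y3 y4 z1 z2 z3 z4 w1 w2 w3 w4
  proof -
    have pull: "10 * ((cc * (- \<i> * h)) * (cc * (- \<i> * h')) + (cc * a) * (cc * a') + (cc * (\<i> * b)) * (cc * (\<i> * b')))
       = 1/4 * (- (h * h') + a * a' - b * b')" for h h' a a' b b'
    proof -
      have "10 * ((cc * (- \<i> * h)) * (cc * (- \<i> * h')) + (cc * a) * (cc * a') + (cc * (\<i> * b)) * (cc * (\<i> * b')))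
         = (10 * (cc * cc)) * ((\<i> * \<i>) * (h * h') + a * a' + (\<i> * \<i>) * (b * b'))"
        by algebra
      then show ?thesis unfolding cc2 by simp
    qed
    show ?thesis
      unfolding G qH qX qY symp_form_frame_comb[OF fr] pull ..
  qed
  \<comment> \<open>For \<open>K\<close> this symmetry came from the Bianchi identity; for the model
    tensor it is checked in coordinates. Both forms are then totally symmetric, and agreement of the
    quartics suffices.\<close>
  have G23: "?G x z y w = ?G x y z w" for x y z w
  proof -
    obtain x1 x2 x3 x4 where x: "x = frame_comb u v x1 x2 x3 x4" by (rule frame_comb_surj[OF dim fr])
    obtain y1 y2 y3 y4 where y: "y = frame_comb u v y1 y2 y3 y4" by (rule frame_comb_surj[OF dim fr])
    obtain z1 z2 z3 z4 where z: "z = frame_comb u v z1 z2 z3 z4" by (rule frame_comb_surj[OF dim fr])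
    obtain w1 w2 w3 w4 where w: "w = frame_comb u v w1 w2 w3 w4" by (rule frame_comb_surj[OF dim fr])
    have s2': "s * (s * t) = 3 * t" for t by (simp add: s2 flip: mult.assoc)
    show ?thesis
      unfolding x y z w Gc by (simp add: algebra_simps s2 s2')
  qed
  have "S_cpx K x y z w - ?G x y z w = 0" for x y z w
  proof (rule quadrilinear_polarization[where f = "\<lambda>x y z w. S_cpx K x y z w - ?G x y z w"])
    show "S_cpx K (x + x') y z w - ?G (x + x') y z w =
       (S_cpx K x y z w - ?G x y z w) + (S_cpx K x' y z w - ?G x' y z w)" for x x' y z w
      by (simp add: S_cpx_add[OF K] G quad_form_add symp_form_add algebra_simps)
    show "S_cpx K y x z w - ?G y x z w = S_cpx K x y z w - ?G x y z w" for x y z w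
      unfolding S_cpx_swap12[OF K, of y x] G quad_form_sym[OF sp(1), of y x] quad_form_sym[OF sp(2), of y x]
        quad_form_sym[OF sp(3), of y x] by (simp add: algebra_simps)
    show "S_cpx K x z y w - ?G x z y w = S_cpx K x y z w - ?G x y z w" for x y z w
      unfolding G23[of x z y w] S_cpx_swap23[OF K, of x z y w] ..
    show "S_cpx K x y w z - ?G x y w z = S_cpx K x y z w - ?G x y z w" for x y z w
      unfolding S_cpx_swap34[OF K, of x y w z] G quad_form_sym[OF sp(1), of w z] quad_form_sym[OF sp(2), of w z]
        quad_form_sym[OF sp(3), of w z] by (simp add: algebra_simps)
    show "S_cpx K x x x x - ?G x x x x = 0" for x
    proof -
      obtain x1 x2 x3 x4 where x: "x = frame_comb u v x1 x2 x3 x4" by (rule frame_comb_surj[OF dim fr])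
      have s2': "s * (s * t) = 3 * t" for t by (simp add: s2 flip: mult.assoc)
      have "S_cpx K x x x x = discr_quartic x1 x2 x3 x4"
        using quart[of x1 x2 x3 x4] by (simp add: x Let_def)
      also have "\<dots> = ?G x x x x"
        unfolding x Gc discr_quartic_def s_def[symmetric]
        by (simp add: algebra_simps power2_eq_square power3_eq_cube s2 s2')
      finally show ?thesis by simp
    qed
  qed
  then have GG: "S_cpx (\<lambda>x y z w. K x y z w - frob_form S x y z w) x y z w = 0" for x y z w
    by (simp add: S_cpx_def complex_eq_iff algebra_simps)
  have "K x y z w - frob_form S x y z w = 0" for x y z w
  proof (rule S_cpx_eq_0D[OF _ _ GG])
    show "K x y w z - frob_form S x y w z = - (K x y z w - frob_form S x y z w)" for x y z w
      using curv_skew(2)[OF K, of x y w z] frob_form_skew(1)[OF Ssp, of x y w z] by simp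
    show "K x y (J1 z) w - frob_form S x y (J1 z) w = - (K x y z (J1 w) - frob_form S x y z (J1 w))"
      for x y z w
      using curv_J(1)[OF K, of x y z w] frob_form_skew(2)[OF Ssp, of x y z w] by simp
  qed
  then have eq: "K x y z w = frob_form S x y z w" for x y z w
    by simp
  have T: "curv_op K A = 5 *\<^sub>R frob_proj H X Y A - (3/2) *\<^sub>R A" if "A \<in> sp" for A
    unfolding curv_op_frob_form[OF K eq that] frob_proj_def sumS ..
  show "A \<in> sp \<Longrightarrow> let B = 2 *\<^sub>R curv_op K A + 3 *\<^sub>R A in 2 *\<^sub>R curv_op K B - 7 *\<^sub>R B = 0"
    "A \<in> sp \<Longrightarrow> B \<in> sp \<Longrightarrow>
      bracket (curv_op K A) (curv_op K B) - curv_op K (bracket (curv_op K A) B) =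
       (3/2) *\<^sub>R (curv_op K (bracket A B) - bracket A (curv_op K B))"
    by (rule orthonormal_triple_conditions[OF K T sp on br]; assumption)+
qed

section \<open>The subalgebra of an operator satisfying the two conditions\<close>

lemma complete_frame:
  assumes dim: "DIM('v) = 8" and u: "u \<bullet> u = 1"
  obtains v where "frame u v"
proof -
  let ?S = "{u, J1 u, J2 u, J3 u}"
  have "dim ?S \<le> card ?S" by (rule dim_le_card') simp
  also have "\<dots> \<le> 4" by (simp add: card_insert_if)
  finally have "dim ?S < DIM('v)" using dim by simp
  then obtain x where x: "x \<noteq> 0" and o: "\<And>y. y \<in> span ?S \<Longrightarrow> orthogonal x y"
    by (rule orthogonal_to_subspace_exists) blast
  have xo: "x \<bullet> y = 0" if "y \<in> ?S" for y
    using o[OF span_base[OF that]] by (simp add: orthogonal_def)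
  define v where "v = (1 / norm x) *\<^sub>R x"
  have "v \<bullet> v = 1" using x by (simp add: v_def dot_square_norm power2_eq_square)
  moreover have "v \<bullet> y = 0" if "y \<in> ?S" for y using xo[OF that] by (simp add: v_def)
  ultimately have "frame u v"
    using u J_inner_swap[of u v] by (simp add: frame_def inner_commute[of u v])
  then show ?thesis by (rule that)
qed

lemma inner_frame:
  assumes "DIM('v) = 8" "frame u v"
  shows "x \<bullet> y = (x \<bullet> u) * (y \<bullet> u) + (x \<bullet> J1 u) * (y \<bullet> J1 u) + (x \<bullet> J2 u) * (y \<bullet> J2 u) + (x \<bullet> J3 u) * (y \<bullet> J3 u)
    + (x \<bullet> v) * (y \<bullet> v) + (x \<bullet> J1 v) * (y \<bullet> J1 v) + (x \<bullet> J2 v) * (y \<bullet> J2 v) + (x \<bullet> J3 v) * (y \<bullet> J3 v)"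
proof -
  have "x \<bullet> y = y \<bullet> (line_part u x + line_part v x)"
    by (simp add: frame_expand[OF assms, of x, symmetric] inner_commute)
  then show ?thesis
    by (simp add: line_part_def inner_right_distrib)
qed

text \<open>The off-diagonal coordinates count twice, once from \<open>A u\<close> and once from
  \<open>A v\<close>.\<close>

lemma frob_coord:
  fixes A B :: "'v \<Rightarrow>\<^sub>L 'v"
  assumes "DIM('v) = 8" "frame u v" and A: "A \<in> sp" and B: "B \<in> sp"
  shows "frob A B = 4 *
     ((A u \<bullet> J1 u) * (B u \<bullet> J1 u) + (A u \<bullet> J2 u) * (B u \<bullet> J2 u) + (A u \<bullet> J3 u) * (B u \<bullet> J3 u)
    + (A v \<bullet> J1 v) * (B v \<bullet> J1 v) + (A v \<bullet> J2 v) * (B v \<bullet> J2 v) + (A v \<bullet> J3 v) * (B v \<bullet> J3 v)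
    + 2 * ((A u \<bullet> v) * (B u \<bullet> v) + (A u \<bullet> J1 v) * (B u \<bullet> J1 v)
      + (A u \<bullet> J2 v) * (B u \<bullet> J2 v) + (A u \<bullet> J3 v) * (B u \<bullet> J3 v)))"
  unfolding frob_frame[OF assms]
  by (subst (1 2) inner_frame[OF assms(1,2)]) (simp add: A B sp2_frame_swap[of _ v u])

text \<open>The Bianchi identity at the quadruples \<open>u, J1 u, J2 u, J3 u\<close>, then
  \<open>u, J1 u, v, J1 v\<close>, then \<open>u, J1 u, J2 v, J3 v\<close>. Commuting with the
  \<open>J\<close>s turns the products into squares; the constants are the wedge terms.\<close>

lemma frob_form_bianchi:
  assumes S: "S \<subseteq> sp" and fr: "frame u v"
    and b: "\<And>x y z w. frob_form S x y z w + frob_form S y z x w + frob_form S z x y w = 0"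
  shows "(\<Sum>A\<in>S. (blinfun_apply A u \<bullet> J1 u)\<^sup>2 + (A u \<bullet> J2 u)\<^sup>2 + (A u \<bullet> J3 u)\<^sup>2) = 9/40"
    and "(\<Sum>A\<in>S. (blinfun_apply A u \<bullet> v)\<^sup>2 + (A u \<bullet> J1 v)\<^sup>2 - (A u \<bullet> J1 u) * (A v \<bullet> J1 v)) = 3/40"
    and "(\<Sum>A\<in>S. (blinfun_apply A u \<bullet> J2 v)\<^sup>2 + (A u \<bullet> J3 v)\<^sup>2 + (A u \<bullet> J1 u) * (A v \<bullet> J1 v)) = 3/40"
proof -
  note fi = frame_inner[OF fr]
  have e: "A \<in> sp" if "A \<in> S" for A using S that by auto
  have s: "frob_form S x y z w + frob_form S y z x w + frob_form S z x y w =
     10 * (\<Sum>A\<in>S. (blinfun_apply A x \<bullet> y) * (A z \<bullet> w) + (A y \<bullet> z) * (A x \<bullet> w) + (A z \<bullet> x) * (A y \<bullet> w))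
     - 3/8 * (sp2_wedge z w x \<bullet> y + sp2_wedge x w y \<bullet> z + sp2_wedge y w z \<bullet> x)" for x y z w
    unfolding frob_form_def sum.distrib by (simp add: algebra_simps)
  have *: "(\<Sum>A\<in>S. (blinfun_apply A x \<bullet> y) * (A z \<bullet> w) + (A y \<bullet> z) * (A x \<bullet> w) + (A z \<bullet> x) * (A y \<bullet> w)) =
     3/80 * (sp2_wedge z w x \<bullet> y + sp2_wedge x w y \<bullet> z + sp2_wedge y w z \<bullet> x)" for x y z w
    using b[of x y z w] unfolding s by simp
  have "(\<Sum>A\<in>S. (blinfun_apply A u \<bullet> J1 u)\<^sup>2 + (A u \<bullet> J2 u)\<^sup>2 + (A u \<bullet> J3 u)\<^sup>2) =
      - (\<Sum>A\<in>S. (blinfun_apply A u \<bullet> J1 u) * (A (J2 u) \<bullet> J3 u) + (A (J1 u) \<bullet> J2 u) * (A u \<bullet> J3 u)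
        + (A (J2 u) \<bullet> u) * (A (J1 u) \<bullet> J3 u))"
    unfolding sum_negf[symmetric]
    by (intro sum.cong refl) (simp add: e sp2D(2-4) power2_eq_square)
  also have "\<dots> = 9/40"
    unfolding * by (simp add: sp2_wedge_inner fi)
  finally show "(\<Sum>A\<in>S. (blinfun_apply A u \<bullet> J1 u)\<^sup>2 + (A u \<bullet> J2 u)\<^sup>2 + (A u \<bullet> J3 u)\<^sup>2) = 9/40" .
  have "(\<Sum>A\<in>S. (blinfun_apply A u \<bullet> v)\<^sup>2 + (A u \<bullet> J1 v)\<^sup>2 - (A u \<bullet> J1 u) * (A v \<bullet> J1 v)) =
      - (\<Sum>A\<in>S. (blinfun_apply A u \<bullet> J1 u) * (A v \<bullet> J1 v) + (A (J1 u) \<bullet> v) * (A u \<bullet> J1 v)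
        + (A v \<bullet> u) * (A (J1 u) \<bullet> J1 v))"
    unfolding sum_negf[symmetric]
    by (intro sum.cong refl) (simp add: e sp2D(2-4) sp2_frame_swap[of _ v u] power2_eq_square)
  also have "\<dots> = 3/40"
    unfolding * by (simp add: sp2_wedge_inner fi)
  finally show "(\<Sum>A\<in>S. (blinfun_apply A u \<bullet> v)\<^sup>2 + (A u \<bullet> J1 v)\<^sup>2 - (A u \<bullet> J1 u) * (A v \<bullet> J1 v)) = 3/40" .
  have "(\<Sum>A\<in>S. (blinfun_apply A u \<bullet> J2 v)\<^sup>2 + (A u \<bullet> J3 v)\<^sup>2 + (A u \<bullet> J1 u) * (A v \<bullet> J1 v)) =
      - (\<Sum>A\<in>S. (blinfun_apply A u \<bullet> J1 u) * (A (J2 v) \<bullet> J3 v) + (A (J1 u) \<bullet> J2 v) * (A u \<bullet> J3 v)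
        + (A (J2 v) \<bullet> u) * (A (J1 u) \<bullet> J3 v))"
    unfolding sum_negf[symmetric]
    by (intro sum.cong refl) (simp add: e sp2D(2-4) sp2_frame_swap[of _ v u] power2_eq_square)
  also have "\<dots> = 3/40"
    unfolding * by (simp add: sp2_wedge_inner fi)
  finally show "(\<Sum>A\<in>S. (blinfun_apply A u \<bullet> J2 v)\<^sup>2 + (A u \<bullet> J3 v)\<^sup>2 + (A u \<bullet> J1 u) * (A v \<bullet> J1 v)) = 3/40" .
qed

text \<open>A weighted sum of the identities of \<open>frob_form_bianchi\<close> for \<open>(u, v)\<close> and \<open>(v, u)\<close> has the squared norms on its left-hand side.\<close>

lemma card_frob_form:
  assumes dim: "DIM('v) = 8" and S: "S \<subseteq> sp" and fr: "frame u v"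
    and b: "\<And>x y z w. frob_form S x y z w + frob_form S y z x w + frob_form S z x y w = 0"
    and on: "\<And>A. A \<in> S \<Longrightarrow> frob A A = 1"
  shows "card S = 3"
proof -
  have split: "(\<Sum>A\<in>S. 4 * f A + 4 * g A + 8 * h A + 8 * k A) =
      4 * sum f S + 4 * sum g S + 8 * sum h S + 8 * sum k S" for f g h k :: "_ \<Rightarrow> real"
    by (simp add: sum.distrib sum_distrib_left)
  have "real (card S) = (\<Sum>A\<in>S. frob A A)" by (simp add: on)
  also have "\<dots> = (\<Sum>A\<in>S. 4 * ((blinfun_apply A u \<bullet> J1 u)\<^sup>2 + (A u \<bullet> J2 u)\<^sup>2 + (A u \<bullet> J3 u)\<^sup>2)
      + 4 * ((A v \<bullet> J1 v)\<^sup>2 + (A v \<bullet> J2 v)\<^sup>2 + (A v \<bullet> J3 v)\<^sup>2)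
      + 8 * ((A u \<bullet> v)\<^sup>2 + (A u \<bullet> J1 v)\<^sup>2 - (A u \<bullet> J1 u) * (A v \<bullet> J1 v))
      + 8 * ((A u \<bullet> J2 v)\<^sup>2 + (A u \<bullet> J3 v)\<^sup>2 + (A u \<bullet> J1 u) * (A v \<bullet> J1 v)))"
    using S by (intro sum.cong refl) (auto simp: frob_coord[OF dim fr] power2_eq_square algebra_simps)
  also have "\<dots> = 4 * (9/40) + 4 * (9/40) + 8 * (3/40) + 8 * (3/40)"
    unfolding split
    unfolding frob_form_bianchi[OF S fr b] frob_form_bianchi(1)[OF S frame_sym[OF fr] b] ..
  finally show ?thesis by simp
qed

lemma conditions_imp_frob_form:
  assumes dim: "DIM('v) = 8" and K: "K \<in> curv_sp2 J1 J2 J3"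
    and I: "\<And>A. A \<in> sp \<Longrightarrow> let B = 2 *\<^sub>R curv_op K A + 3 *\<^sub>R A in 2 *\<^sub>R curv_op K B - 7 *\<^sub>R B = 0"
    and II: "\<And>A B. A \<in> sp \<Longrightarrow> B \<in> sp \<Longrightarrow>
      bracket (curv_op K A) (curv_op K B) - curv_op K (bracket (curv_op K A) B) =
       (3/2) *\<^sub>R (curv_op K (bracket A B) - bracket A (curv_op K B))"
  obtains S where "S \<subseteq> sp" "\<And>A. A \<in> S \<Longrightarrow> frob A A = 1"
    "\<And>A B. A \<in> S \<Longrightarrow> B \<in> S \<Longrightarrow> A \<noteq> B \<Longrightarrow> frob A B = 0"
    "\<And>x y z w. K x y z w = frob_form S x y z w"
    "\<And>A B. A \<in> S \<Longrightarrow> B \<in> S \<Longrightarrow> bracket A B = (\<Sum>C\<in>S. frob (bracket A B) C *\<^sub>R C)"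
proof -
  obtain b :: 'v where "b \<in> Basis" by fastforce
  then have "b \<bullet> b = 1" by simp
  then obtain u v where fr: "frame u v"
    using complete_frame[OF dim] by blast
  define P where "P A = (1/10) *\<^sub>R (2 *\<^sub>R curv_op K A + 3 *\<^sub>R A)" for A
  have T: "curv_op K A = 5 *\<^sub>R P A - (3/2) *\<^sub>R A" for A
    by (simp add: P_def algebra_simps flip: scaleR_add_left)
  note lin = curv_op_linear[OF K]
  have T_sp: "curv_op K A \<in> sp" for A
    using curv_op_in_sp2[OF hh K] .
  have P_sp: "P A \<in> sp" if "A \<in> sp" for A
    using that by (simp add: P_def sp2_closed T_sp)
  have P_lin: "P (A + B) = P A + P B" "P (r *\<^sub>R A) = r *\<^sub>R P A" "P (A - B) = P A - P B" for A B r
    by (simp_all add: P_def lin algebra_simps)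
  have P_P: "P (P A) = P A" if "A \<in> sp" for A
  proof -
    have PA: "2 *\<^sub>R curv_op K A + 3 *\<^sub>R A = 10 *\<^sub>R P A" by (simp add: P_def)
    have "2 *\<^sub>R curv_op K (10 *\<^sub>R P A) - 7 *\<^sub>R (10 *\<^sub>R P A) = 0"
      using I[OF that] unfolding Let_def PA .
    then have "20 *\<^sub>R curv_op K (P A) = 70 *\<^sub>R P A"
      by (simp add: lin)
    then have "(1/10) *\<^sub>R (20 *\<^sub>R curv_op K (P A)) = (1/10) *\<^sub>R (70 *\<^sub>R P A)"
      by (rule arg_cong)
    then have "2 *\<^sub>R curv_op K (P A) = 7 *\<^sub>R P A" by simp
    then show ?thesis by (simp add: P_def[of "P A"] flip: scaleR_add_left)
  qed
  have P_sym: "frob (P A) B = frob A (P B)" for A B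
    by (simp add: P_def frob_bilinear curv_op_sym[OF K])
  \<comment> \<open>On the range of \<open>P\<close> the operator is multiplication by 7/2, so (II)
    says that [A, B] is again an eigenvector for 7/2.\<close>
  have P_br: "P (bracket A B) = bracket A B" if "A \<in> sp" "B \<in> sp" "P A = A" "P B = B" for A B
  proof -
    let ?X = "bracket A B" and ?Y = "curv_op K (bracket A B)"
    have TA: "curv_op K A = (7/2) *\<^sub>R A" "curv_op K B = (7/2) *\<^sub>R B"
      by (simp_all add: T that flip: scaleR_diff_left)
    have "(49/4) *\<^sub>R ?X - (7/2) *\<^sub>R ?Y = (3/2) *\<^sub>R (?Y - (7/2) *\<^sub>R ?X)"
      using II[OF that(1,2)] by (simp add: TA bracket_bilinear lin)
    then have "5 *\<^sub>R ?Y = (35/2) *\<^sub>R ?X"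
    proof -
      assume e: "(49/4) *\<^sub>R ?X - (7/2) *\<^sub>R ?Y = (3/2) *\<^sub>R (?Y - (7/2) *\<^sub>R ?X)"
      have "5 *\<^sub>R Y - (35/2) *\<^sub>R X =
          (3/2) *\<^sub>R (Y - (7/2) *\<^sub>R X) - ((49/4) *\<^sub>R X - (7/2) *\<^sub>R Y)" for X Y :: "'v \<Rightarrow>\<^sub>L 'v"
        by (rule blinfun_eqI) (simp add: euclidean_eq_iff[where 'a='v] inner_diff_left algebra_simps)
      from this[of ?Y ?X] show ?thesis using e by simp
    qed
    then have "(1/25) *\<^sub>R (5 *\<^sub>R ?Y) = (1/25) *\<^sub>R ((35/2) *\<^sub>R ?X)"
      by (rule arg_cong)
    then have Y: "(1/10) *\<^sub>R (2 *\<^sub>R ?Y) = (7/10) *\<^sub>R ?X" by simp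
    have "P ?X = (1/10) *\<^sub>R (2 *\<^sub>R ?Y) + (3/10) *\<^sub>R ?X" by (simp add: P_def scaleR_add_right)
    also have "\<dots> = ?X" unfolding Y by (simp flip: scaleR_add_left)
    finally show ?thesis .
  qed
  let ?h = "{A \<in> sp. P A = A}"
  \<comment> \<open>An isometric embedding of sp(2) with \<open>frob\<close> into the Euclidean
    space of pairs, by \<open>frob_frame\<close>; an orthonormal basis of the fixed space of
    \<open>P\<close> is pulled back from there.\<close>
  let ?\<phi> = "\<lambda>A. (2 *\<^sub>R blinfun_apply A u, 2 *\<^sub>R blinfun_apply A v)"
  have frob_\<phi>: "?\<phi> A \<bullet> ?\<phi> B = frob A B" if "A \<in> sp" "B \<in> sp" for A B
    using that by (simp add: frob_frame[OF dim fr])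
  have inj_\<phi>: "A = B" if "A \<in> sp" "B \<in> sp" "?\<phi> A = ?\<phi> B" for A B
    using that by (intro sp2_eqI[OF dim fr]) auto
  have sub: "subspace (?\<phi> ` ?h)"
  proof (rule subspaceI)
    show "0 \<in> ?\<phi> ` ?h"
      using P_lin(2)[of 0 0] by (intro image_eqI[of _ _ 0]) (simp_all add: sp2_closed zero_prod_def)
    show "x + y \<in> ?\<phi> ` ?h" if "x \<in> ?\<phi> ` ?h" "y \<in> ?\<phi> ` ?h" for x y
    proof -
      obtain A B where "A \<in> ?h" "x = ?\<phi> A" "B \<in> ?h" "y = ?\<phi> B" using \<open>x \<in> _\<close> \<open>y \<in> _\<close> by blast
      then show ?thesis
        by (intro image_eqI[of _ _ "A + B"]) (simp_all add: sp2_closed P_lin scaleR_add_right)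
    qed
    show "r *\<^sub>R x \<in> ?\<phi> ` ?h" if "x \<in> ?\<phi> ` ?h" for r x
    proof -
      obtain A where "A \<in> ?h" "x = ?\<phi> A" using \<open>x \<in> _\<close> by blast
      then show ?thesis
        by (intro image_eqI[of _ _ "r *\<^sub>R A"]) (simp_all add: sp2_closed P_lin)
    qed
  qed
  obtain Bs where Bs: "Bs \<subseteq> ?\<phi> ` ?h" "pairwise orthogonal Bs" "\<And>x. x \<in> Bs \<Longrightarrow> norm x = 1"
    "independent Bs" "card Bs = dim (?\<phi> ` ?h)" "span Bs = ?\<phi> ` ?h"
    by (rule orthonormal_basis_subspace[OF sub]) (rule that)
  have finB: "finite Bs" using Bs(4) by (rule finiteI_independent)
  define \<psi> where "\<psi> = inv_into ?h ?\<phi>"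
  have \<psi>: "\<psi> b \<in> sp" "P (\<psi> b) = \<psi> b" "?\<phi> (\<psi> b) = b" if "b \<in> Bs" for b
  proof -
    have "b \<in> ?\<phi> ` ?h" using that Bs(1) by blast
    then show "\<psi> b \<in> sp" "P (\<psi> b) = \<psi> b" "?\<phi> (\<psi> b) = b"
      using inv_into_into[of b ?\<phi> ?h] f_inv_into_f[of b ?\<phi> ?h] by (auto simp: \<psi>_def)
  qed
  have inj_\<psi>: "inj_on \<psi> Bs" by (rule inj_on_inverseI) (rule \<psi>(3))
  have expand: "A = (\<Sum>C\<in>\<psi> ` Bs. frob A C *\<^sub>R C)" if A: "A \<in> sp" "P A = A" for A
  proof (rule inj_\<phi>[OF A(1)])
    show "(\<Sum>C\<in>\<psi> ` Bs. frob A C *\<^sub>R C) \<in> sp"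
      by (rule sp2_sum) (auto intro: sp2_closed \<psi>)
    have "?\<phi> A \<in> span Bs" using A Bs(6) by blast
    then have "?\<phi> A = (\<Sum>b\<in>Bs. (?\<phi> A \<bullet> b) *\<^sub>R b)"
      using orthonormal_basis_expand[OF Bs(2,3) _ finB, of "?\<phi> A"] by simp
    also have "\<dots> = (\<Sum>b\<in>Bs. frob A (\<psi> b) *\<^sub>R ?\<phi> (\<psi> b))"
    proof (rule sum.cong[OF refl])
      fix b assume b: "b \<in> Bs"
      show "(?\<phi> A \<bullet> b) *\<^sub>R b = frob A (\<psi> b) *\<^sub>R ?\<phi> (\<psi> b)"
        using frob_\<phi>[OF A(1) \<psi>(1)[OF b]] unfolding \<psi>(3)[OF b] by simp
    qed
    also have "\<dots> = ?\<phi> (\<Sum>C\<in>\<psi> ` Bs. frob A C *\<^sub>R C)"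
      by (simp add: sum.reindex[OF inj_\<psi>] blinfun.sum_left scaleR_sum_right prod_eq_iff fst_sum snd_sum mult.commute)
    finally show "?\<phi> A = ?\<phi> (\<Sum>C\<in>\<psi> ` Bs. frob A C *\<^sub>R C)" .
  qed
  show ?thesis
  proof
    show "\<psi> ` Bs \<subseteq> sp" using \<psi> by blast
    show "frob A A = 1" if A: "A \<in> \<psi> ` Bs" for A
    proof -
      obtain b where b: "b \<in> Bs" "A = \<psi> b" using A by blast
      show ?thesis
        using frob_\<phi>[OF \<psi>(1)[OF b(1)] \<psi>(1)[OF b(1)]] Bs(3)[OF b(1)]
        unfolding \<psi>(3)[OF b(1)] b(2) by (simp add: norm_eq_1)
    qed
    show "frob A B = 0" if A: "A \<in> \<psi> ` Bs" "B \<in> \<psi> ` Bs" "A \<noteq> B" for A B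
    proof -
      obtain b c where b: "b \<in> Bs" "A = \<psi> b" "c \<in> Bs" "B = \<psi> c" using A by blast
      with A have "b \<noteq> c" by auto
      then have "b \<bullet> c = 0" using Bs(2) b by (auto simp: pairwise_def orthogonal_def)
      then show ?thesis
        using frob_\<phi>[OF \<psi>(1)[OF b(1)] \<psi>(1)[OF b(3)]]
        unfolding \<psi>(3)[OF b(1)] \<psi>(3)[OF b(3)] b(2,4) by simp
    qed
    show "bracket A B = (\<Sum>C\<in>\<psi> ` Bs. frob (bracket A B) C *\<^sub>R C)"
      if "A \<in> \<psi> ` Bs" "B \<in> \<psi> ` Bs" for A B
      using that \<psi> by (intro expand) (auto intro!: sp2_bracket P_br)
    show "K x y z w = frob_form (\<psi> ` Bs) x y z w" for x y z w
    proof -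
      have "4 * K x y z w = curv_op K (sp2_wedge z w) x \<bullet> y"
        by (simp add: curv_op_sp2_wedge[OF K])
      also have "\<dots> = 5 * (P (sp2_wedge z w) x \<bullet> y) - 3/2 * (sp2_wedge z w x \<bullet> y)"
        by (simp add: T inner_diff_left)
      also have "P (sp2_wedge z w) = (\<Sum>C\<in>\<psi> ` Bs. frob (P (sp2_wedge z w)) C *\<^sub>R C)"
        by (rule expand) (simp_all add: P_sp P_P sp2_wedge_in_sp2)
      also have "\<dots> = (\<Sum>C\<in>\<psi> ` Bs. (8 * (blinfun_apply C z \<bullet> w)) *\<^sub>R C)"
      proof (rule sum.cong[OF refl])
        fix C assume "C \<in> \<psi> ` Bs"
        then have "P C = C" "C \<in> sp" using \<psi> by blast+
        then show "frob (P (sp2_wedge z w)) C *\<^sub>R C = (8 * (C z \<bullet> w)) *\<^sub>R C"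
          by (simp add: P_sym frob_commute[of "sp2_wedge z w"] frob_sp2_wedge)
      qed
      also have "(\<Sum>C\<in>\<psi> ` Bs. (8 * (blinfun_apply C z \<bullet> w)) *\<^sub>R C) x \<bullet> y =
          8 * (\<Sum>C\<in>\<psi> ` Bs. (blinfun_apply C x \<bullet> y) * (blinfun_apply C z \<bullet> w))"
        by (simp add: blinfun.sum_left inner_sum_left sum_distrib_left mult_ac)
      finally show ?thesis by (simp add: frob_form_def)
    qed
  qed
qed

section \<open>Identification of the principal subalgebra\<close>

text \<open>The vector \<open>l *\<^sub>R w - J1 (H w)\<close> solves the equation unless it is
  zero. In that case \<open>w\<close> has weight \<open>- l\<close>, and \<open>J2 w\<close> has
  weight \<open>l\<close> because \<open>J2\<close> anticommutes with \<open>J1\<close>.\<close>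

lemma J1_eigenvector:
  fixes H :: "'v \<Rightarrow>\<^sub>L 'v"
  assumes H: "H \<in> sp" and w: "w \<in> X" "w \<noteq> 0" and HH: "H (H w) = - (l * l) *\<^sub>R w"
    and X: "subspace X" "\<And>x. x \<in> X \<Longrightarrow> J1 x \<in> X" "\<And>x. x \<in> X \<Longrightarrow> J2 x \<in> X" "\<And>x. x \<in> X \<Longrightarrow> H x \<in> X"
  obtains u where "u \<bullet> u = 1" "H u = l *\<^sub>R J1 u" "u \<in> X"
proof -
  have "\<exists>x\<in>X. x \<noteq> 0 \<and> H x = l *\<^sub>R J1 x"
  proof (cases "l *\<^sub>R w = J1 (H w)")
    case True
    then have "J1 (l *\<^sub>R w) = - H w" by simp
    then have "H w = - l *\<^sub>R J1 w" by (simp add: minus_equation_iff[of "H w"])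
    then have "H (J2 w) = l *\<^sub>R J1 (J2 w)" by (simp add: sp2D[OF H])
    moreover have "J2 w \<noteq> 0" using w(2) J_mult(5)[of w] by (metis blinfun.zero_right neg_equal_0_iff_equal)
    ultimately show ?thesis using X w(1) by blast
  next
    case False
    let ?x = "l *\<^sub>R w - J1 (H w)"
    have "H ?x = l *\<^sub>R J1 ?x"
      using HH by (simp add: sp2D[OF H] algebra_simps)
    moreover have "?x \<in> X" by (intro subspace_diff[OF X(1)] subspace_scale[OF X(1)] X w)
    ultimately show ?thesis using False by (intro bexI[of _ ?x]) auto
  qed
  then obtain x where x: "x \<in> X" "x \<noteq> 0" "H x = l *\<^sub>R J1 x" by blast
  show ?thesis
  proof
    show "(1 / norm x) *\<^sub>R x \<bullet> (1 / norm x) *\<^sub>R x = 1"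
      using x by (simp add: dot_square_norm power2_eq_square)
    show "H ((1 / norm x) *\<^sub>R x) = l *\<^sub>R J1 ((1 / norm x) *\<^sub>R x)"
      using x by simp
    show "(1 / norm x) *\<^sub>R x \<in> X" by (intro subspace_scale[OF X(1)] x)
  qed
qed

text \<open>The maximal stretch of \<open>H\<close> supplies the first weight \<open>l\<close>. The
  complement of the quaternionic line of \<open>u\<close> is again a quaternionic line preserved by
  \<open>H\<close>, and maximality bounds its weight by \<open>l\<close>.\<close>

lemma sp2_diagonalize:
  fixes H :: "'v \<Rightarrow>\<^sub>L 'v"
  assumes dim: "DIM('v) = 8" and H: "H \<in> sp"
  obtains u v l m where "frame u v" "H u = l *\<^sub>R J1 u" "H v = m *\<^sub>R J1 v" "0 \<le> m" "m \<le> l"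
proof -
  obtain w M where w: "w \<bullet> w = 1" "0 \<le> M" "H (H w) = - M *\<^sub>R w"
    and le: "\<And>x. H x \<bullet> H x \<le> M * (x \<bullet> x)"
    using skew_max_eigenvector[of H] sp2D(1)[OF H] by blast
  define l where "l = sqrt M"
  have l: "0 \<le> l" "l * l = M" using w by (simp_all add: l_def)
  have "w \<noteq> 0" using w by auto
  then obtain u where u: "u \<bullet> u = 1" "H u = l *\<^sub>R J1 u"
    using J1_eigenvector[OF H, of w UNIV l] w l by auto
  obtain v0 where fr0: "frame u v0" using complete_frame[OF dim u(1)] by blast
  let ?X = "{x. x \<bullet> u = 0 \<and> x \<bullet> J1 u = 0 \<and> x \<bullet> J2 u = 0 \<and> x \<bullet> J3 u = 0}"
  have sub: "subspace ?X" by (rule subspaceI) (simp_all add: inner_left_distrib)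
  have XH: "H x \<in> ?X" if "x \<in> ?X" for x
    using that by (simp add: sp2D[OF H] u)
  have v0: "v0 \<in> ?X" using frame_inner[OF fr0] by simp
  have "H v0 = line_part u (H v0) + line_part v0 (H v0)"
    by (rule frame_expand[OF dim fr0])
  also have "line_part u (H v0) = 0"
    using XH[OF v0] by (simp add: line_part_def)
  finally have Hv0: "H v0 = (H v0 \<bullet> J1 v0) *\<^sub>R J1 v0 + (H v0 \<bullet> J2 v0) *\<^sub>R J2 v0 + (H v0 \<bullet> J3 v0) *\<^sub>R J3 v0"
    (is "_ = ?r1 *\<^sub>R _ + ?r2 *\<^sub>R _ + ?r3 *\<^sub>R _")
    using H by (simp add: line_part_def)
  \<comment> \<open>\<open>H\<close> multiplies \<open>v0\<close> by an imaginary quaternion;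
    \<open>m\<close> is its length, so \<open>H\<close> squared acts on \<open>v0\<close> by
    \<open>- (m * m)\<close>.\<close>
  define m where "m = sqrt (?r1\<^sup>2 + ?r2\<^sup>2 + ?r3\<^sup>2)"
  have m: "0 \<le> m" "m * m = ?r1\<^sup>2 + ?r2\<^sup>2 + ?r3\<^sup>2" by (simp_all add: m_def)
  have "H (r1 *\<^sub>R J1 v0 + r2 *\<^sub>R J2 v0 + r3 *\<^sub>R J3 v0) = - (r1\<^sup>2 + r2\<^sup>2 + r3\<^sup>2) *\<^sub>R v0"
    if "H v0 = r1 *\<^sub>R J1 v0 + r2 *\<^sub>R J2 v0 + r3 *\<^sub>R J3 v0" for r1 r2 r3
    by (simp add: sp2D[OF H] that power2_eq_square algebra_simps)
  from this[OF Hv0] have HHv0: "H (H v0) = - (m * m) *\<^sub>R v0"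
    using Hv0 m by simp
  have "v0 \<noteq> 0" using frame_inner(2)[OF fr0] by auto
  then obtain v where v: "v \<bullet> v = 1" "H v = m *\<^sub>R J1 v" "v \<in> ?X"
    using J1_eigenvector[OF H v0 _ HHv0 sub] XH by (auto simp: )
  have fr: "frame u v"
    using u v J_inner_swap[of u v] by (simp add: frame_def inner_commute[of u v])
  have "m * m \<le> l * l" using le[of v] v(1) by (simp add: v(2) l)
  then have "m \<le> l" using l(1) m(1) by (metis abs_le_square_iff abs_of_nonneg power2_eq_square)
  then show ?thesis using that fr u v m by blast
qed

text \<open>The root decomposition in real form: \<open>ad H\<close> kills the diagonal
  \<open>J1\<close> coordinate and rotates the other pairs of coordinates with speeds
  \<open>2 * l\<close>, \<open>l - m\<close> and \<open>l + m\<close>.\<close>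

lemma bracket_diagonal:
  fixes H A :: "'v \<Rightarrow>\<^sub>L 'v"
  assumes H: "H \<in> sp" and A: "A \<in> sp" and d: "H u = l *\<^sub>R J1 u" "H v = m *\<^sub>R J1 v"
  shows "bracket H A u \<bullet> J1 u = 0" "bracket H A u \<bullet> J2 u = 2 * l * (A u \<bullet> J3 u)"
    "bracket H A u \<bullet> J3 u = - 2 * l * (A u \<bullet> J2 u)"
    "bracket H A u \<bullet> v = (l - m) * (A u \<bullet> J1 v)" "bracket H A u \<bullet> J1 v = - (l - m) * (A u \<bullet> v)"
    "bracket H A u \<bullet> J2 v = (l + m) * (A u \<bullet> J3 v)" "bracket H A u \<bullet> J3 v = - (l + m) * (A u \<bullet> J2 v)"
proof -
  have i: "H (A u) \<bullet> y = - (A u \<bullet> H y)" for y by (rule sp2D(1)[OF H])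
  show "bracket H A u \<bullet> J1 u = 0" "bracket H A u \<bullet> J2 u = 2 * l * (A u \<bullet> J3 u)"
    "bracket H A u \<bullet> J3 u = - 2 * l * (A u \<bullet> J2 u)"
    "bracket H A u \<bullet> v = (l - m) * (A u \<bullet> J1 v)" "bracket H A u \<bullet> J1 v = - (l - m) * (A u \<bullet> v)"
    "bracket H A u \<bullet> J2 v = (l + m) * (A u \<bullet> J3 v)" "bracket H A u \<bullet> J3 v = - (l + m) * (A u \<bullet> J2 v)"
    using A by (simp_all add: bracket_apply inner_diff_left i d sp2D(2-4)[OF H] sp2D(2-4)[OF A]
        algebra_simps)
qed

lemma J1_scale_frame:
  assumes "frame u v" "cmod z = 1"
  shows "frame (J1_scale z u) v"
proof -
  have "(Re z)\<^sup>2 + (Im z)\<^sup>2 = 1" using assms(2) by (simp add: cmod_def)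
  then show ?thesis
    using frame_inner[OF assms(1)]
    by (simp add: frame_def J1_scale_def inner_left_distrib inner_right_distrib power2_eq_square)
qed

text \<open>Rephasing \<open>u\<close> rephases \<open>J2 u\<close> by the conjugate, since
  \<open>J2\<close> anticommutes with \<open>J1\<close>.\<close>

lemma frame_comb_J1_scale: "frame_comb (J1_scale z u) v x1 x2 x3 x4 = frame_comb u v (x1 * z) x2 (x3 * cnj z) x4"
  by (simp add: frame_comb_def J1_scale_def algebra_simps)

lemma symp_form_self: "symp_form x x = 0"
  by (simp add: symp_form_def complex_eq_iff)

lemma conditions_imp_discr_curv:
  assumes dim: "DIM('v) = 8" and K: "K \<in> curv_sp2 J1 J2 J3"
    and I: "\<And>A. A \<in> sp \<Longrightarrow> let B = 2 *\<^sub>R curv_op K A + 3 *\<^sub>R A in 2 *\<^sub>R curv_op K B - 7 *\<^sub>R B = 0"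
    and II: "\<And>A B. A \<in> sp \<Longrightarrow> B \<in> sp \<Longrightarrow>
      bracket (curv_op K A) (curv_op K B) - curv_op K (bracket (curv_op K A) B) =
       (3/2) *\<^sub>R (curv_op K (bracket A B) - bracket A (curv_op K B))"
  shows "K \<in> discr_curv J1 J2 J3"
proof -
  obtain S where S: "S \<subseteq> sp" and unit: "\<And>A. A \<in> S \<Longrightarrow> frob A A = 1"
    and orth: "\<And>A B. A \<in> S \<Longrightarrow> B \<in> S \<Longrightarrow> A \<noteq> B \<Longrightarrow> frob A B = 0"
    and form: "\<And>x y z w. K x y z w = frob_form S x y z w"
    and closed: "\<And>A B. A \<in> S \<Longrightarrow> B \<in> S \<Longrightarrow> bracket A B = (\<Sum>C\<in>S. frob (bracket A B) C *\<^sub>R C)"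
    using conditions_imp_frob_form[OF dim K I II] by blast
  have bi: "frob_form S x y z w + frob_form S y z x w + frob_form S z x y w = 0" for x y z w
    using curv_bianchi[OF K, of x y z w] by (simp add: form)
  obtain b :: 'v where "b \<in> Basis" by fastforce
  then have "b \<bullet> b = 1" by simp
  then obtain u0 v0 where "frame u0 v0"
    using complete_frame[OF dim] by blast
  then have "card S = 3"
    by (rule card_frob_form[OF dim S _ bi unit])
  then obtain H A B where SH: "S = {H, A, B}" and ne: "H \<noteq> A" "A \<noteq> B" "H \<noteq> B"
    unfolding card_3_iff by blast
  have sumS: "(\<Sum>C\<in>S. f C) = f H + f A + f B" for f :: "_ \<Rightarrow> 'b::comm_monoid_add"
    using ne by (simp add: SH add.assoc)
  have sp: "H \<in> sp" "A \<in> sp" "B \<in> sp" using S by (simp_all add: SH)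
  have on: "frob H H = 1" "frob A A = 1" "frob B B = 1" "frob H A = 0" "frob H B = 0" "frob A B = 0"
    using unit orth ne by (simp_all add: SH)
  have fb: "frob (bracket X Y) Z = - frob Y (bracket X Z)" if "X \<in> sp" "Y \<in> sp" for X Y Z
    by (rule frob_bracket[OF sp2D(1)[OF that(1)] sp2D(1)[OF that(2)]])
  \<comment> \<open>By invariance \<open>frob (bracket X Y) Z\<close> is skew in all three arguments
    on \<open>S\<close>, so one number describes all brackets of the three basis elements.\<close>
  define \<nu> where "\<nu> = frob (bracket H A) B"
  have f0: "frob (bracket X Y) X = 0" "frob (bracket X Y) Y = 0" if "X \<in> sp" "Y \<in> sp" for X Y
    using fb[OF that, of X] fb[OF that, of Y] frob_commute[of Y "bracket X Y"]
    by (simp_all add: bracket_bilinear frob_bilinear)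
  have f1: "frob (bracket H B) A = - \<nu>" "frob (bracket A B) H = \<nu>"
    using fb[OF sp(1,3), of A] fb[OF sp(2,3), of H] bracket_commute[of A H]
    by (simp_all add: \<nu>_def frob_commute[of B] frob_bilinear)
  have HA: "bracket H A = \<nu> *\<^sub>R B"
    using closed[of H A] by (simp add: SH[symmetric] sumS) (simp add: SH f0 sp \<nu>_def)
  have HB: "bracket H B = - \<nu> *\<^sub>R A"
    using closed[of H B] by (simp add: SH[symmetric] sumS) (simp add: SH f0 sp f1)
  have AB: "bracket A B = \<nu> *\<^sub>R H"
    using closed[of A B] by (simp add: SH[symmetric] sumS) (simp add: SH f0 sp f1)
  obtain u v l m where fr: "frame u v" and Hu: "H u = l *\<^sub>R J1 u" and Hv: "H v = m *\<^sub>R J1 v"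
    and lm: "0 \<le> m" "m \<le> l"
    using sp2_diagonalize[OF dim sp(1)] by blast
  note fi = frame_inner[OF fr]
  note fr' = frame_sym[OF fr]
  have br: "bracket H A x \<bullet> y = \<nu> * (B x \<bullet> y)" "bracket H B x \<bullet> y = - \<nu> * (A x \<bullet> y)" for x y
    by (simp_all add: HA HB)
  note uA = bracket_diagonal[OF sp(1) sp(2) Hu Hv, unfolded br, symmetric]
    and vA = bracket_diagonal(1-3)[OF sp(1) sp(2) Hv Hu, unfolded br, symmetric]
    and uB = bracket_diagonal[OF sp(1) sp(3) Hu Hv, unfolded br, symmetric]
    and vB = bracket_diagonal(1-3)[OF sp(1) sp(3) Hv Hu, unfolded br, symmetric]
  note roots = uA(2,3) uB(2,3) vA(2,3) vB(2,3) uA(4,5) uB(4,5) uA(6,7) uB(6,7)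
  have bi1: "l\<^sup>2 + ((A u \<bullet> J1 u)\<^sup>2 + (A u \<bullet> J2 u)\<^sup>2 + (A u \<bullet> J3 u)\<^sup>2)
      + ((B u \<bullet> J1 u)\<^sup>2 + (B u \<bullet> J2 u)\<^sup>2 + (B u \<bullet> J3 u)\<^sup>2) = 9/40"
    using frob_form_bianchi(1)[OF S fr bi] unfolding sumS Hu Hv by (simp add: fi)
  have bi2: "m\<^sup>2 + ((A v \<bullet> J1 v)\<^sup>2 + (A v \<bullet> J2 v)\<^sup>2 + (A v \<bullet> J3 v)\<^sup>2)
      + ((B v \<bullet> J1 v)\<^sup>2 + (B v \<bullet> J2 v)\<^sup>2 + (B v \<bullet> J3 v)\<^sup>2) = 9/40"
    using frob_form_bianchi(1)[OF S fr' bi] unfolding sumS Hu Hv by (simp add: fi)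
  have bi3: "((A u \<bullet> v)\<^sup>2 + (A u \<bullet> J1 v)\<^sup>2 - (A u \<bullet> J1 u) * (A v \<bullet> J1 v))
      + ((B u \<bullet> v)\<^sup>2 + (B u \<bullet> J1 v)\<^sup>2 - (B u \<bullet> J1 u) * (B v \<bullet> J1 v)) - l * m = 3/40"
    using frob_form_bianchi(2)[OF S fr bi] unfolding sumS Hu Hv by (simp add: fi)
  have bi4: "((A u \<bullet> J2 v)\<^sup>2 + (A u \<bullet> J3 v)\<^sup>2 + (A u \<bullet> J1 u) * (A v \<bullet> J1 v))
      + ((B u \<bullet> J2 v)\<^sup>2 + (B u \<bullet> J3 v)\<^sup>2 + (B u \<bullet> J1 u) * (B v \<bullet> J1 v)) + l * m = 3/40"
    using frob_form_bianchi(3)[OF S fr bi] unfolding sumS Hu Hv by (simp add: fi)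
  have "frob H H = 4 * (l * l + m * m)"
    unfolding frob_coord[OF dim fr sp(1,1)] by (simp add: Hu Hv fi)
  then have l0: "l \<noteq> 0" using on(1) lm by auto
  have \<nu>0: "\<nu> \<noteq> 0"
  proof
    assume \<nu>: "\<nu> = 0"
    have hA: "l * (A u \<bullet> J1 u) + m * (A v \<bullet> J1 v) = 0" "l * (B u \<bullet> J1 u) + m * (B v \<bullet> J1 v) = 0"
      using on(4,5) unfolding frob_coord[OF dim fr sp(1,2)] frob_coord[OF dim fr sp(1,3)]
      by (simp_all add: Hu Hv fi)
    note z = rank_analysis[OF lm l0 \<nu> bi3 bi4 roots hA]
    have val: "X u = (X u \<bullet> J1 u) *\<^sub>R J1 u + (X u \<bullet> v) *\<^sub>R v + (X u \<bullet> J1 v) *\<^sub>R J1 v"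
      "X v = - (X u \<bullet> J1 u) *\<^sub>R J1 v - (X u \<bullet> v) *\<^sub>R u + (X u \<bullet> J1 v) *\<^sub>R J1 u"
      if "X \<in> {A, B}" for X
    proof -
      have X: "X \<in> sp" using that sp by auto
      show "X u = (X u \<bullet> J1 u) *\<^sub>R J1 u + (X u \<bullet> v) *\<^sub>R v + (X u \<bullet> J1 v) *\<^sub>R J1 v"
        using frame_expand[OF dim fr, of "X u"] that X by (auto simp: line_part_def z add.assoc)
      show "X v = - (X u \<bullet> J1 u) *\<^sub>R J1 v - (X u \<bullet> v) *\<^sub>R u + (X u \<bullet> J1 v) *\<^sub>R J1 u"
        using frame_expand[OF dim fr, of "X v"] that X
        by (auto simp: line_part_def z sp2_frame_swap[OF X, of v u])
    qed
    \<comment> \<open>For operators of this shape the bracket is a cross product of coordinate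
      vectors. Commuting makes the vectors of \<open>A\<close> and \<open>B\<close> parallel, while
      \<open>frob\<close> makes them orthogonal and nonzero.\<close>
    have c: "q0' * q1 - q1' * q0 = 0" "p * q1' - p' * q1 = 0" "p * q0' - p' * q0 = 0"
      if X: "A u = p *\<^sub>R J1 u + q0 *\<^sub>R v + q1 *\<^sub>R J1 v" "A v = - p *\<^sub>R J1 v - q0 *\<^sub>R u + q1 *\<^sub>R J1 u"
        "B u = p' *\<^sub>R J1 u + q0' *\<^sub>R v + q1' *\<^sub>R J1 v" "B v = - p' *\<^sub>R J1 v - q0' *\<^sub>R u + q1' *\<^sub>R J1 u"
      for p q0 q1 p' q0' q1'
    proof -
      have "bracket A B u \<bullet> J1 u = 0" "bracket A B u \<bullet> v = 0" "bracket A B u \<bullet> J1 v = 0"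
        unfolding AB \<nu> by simp_all
      then show "q0' * q1 - q1' * q0 = 0" "p * q1' - p' * q1 = 0" "p * q0' - p' * q0 = 0"
        by (simp_all add: bracket_apply X sp2D(2-4)[OF sp(2)] sp2D(2-4)[OF sp(3)]
           inner_diff_left inner_left_distrib fi algebra_simps)
    qed
    note c = c[OF val[of A] val[of B], simplified]
    have "8 * ((A u \<bullet> J1 u) * (B u \<bullet> J1 u) + (A u \<bullet> v) * (B u \<bullet> v) + (A u \<bullet> J1 v) * (B u \<bullet> J1 v)) = 0"
      "8 * ((A u \<bullet> J1 u) * (A u \<bullet> J1 u) + (A u \<bullet> v) * (A u \<bullet> v) + (A u \<bullet> J1 v) * (A u \<bullet> J1 v)) = 1"
      "8 * ((B u \<bullet> J1 u) * (B u \<bullet> J1 u) + (B u \<bullet> v) * (B u \<bullet> v) + (B u \<bullet> J1 v) * (B u \<bullet> J1 v)) = 1"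
      using on(2,3,6)
      unfolding frob_coord[OF dim fr sp(2,3)] frob_coord[OF dim fr sp(2,2)] frob_coord[OF dim fr sp(3,3)]
      by (simp_all add: z)
    with c show False by algebra
  qed
  have p1: "A u \<bullet> J1 u = 0" "B u \<bullet> J1 u = 0" "A v \<bullet> J1 v = 0" "B v \<bullet> J1 v = 0"
    using uA(1) vA(1) uB(1) vB(1) \<nu>0 by simp_all
  note bi' = bi1 bi2 bi3 bi4
  note bi' = bi'[unfolded p1 mult_zero_left zero_power2 add_0_left add_0_right diff_0_right]
  obtain s where s: "s * s = 1" "l = 3 * m" "m\<^sup>2 = 1/40" 
    "A u \<bullet> J2 u = 0" "A u \<bullet> J3 u = 0" "B u \<bullet> J2 u = 0" "B u \<bullet> J3 u = 0"
    "A u \<bullet> J2 v = 0" "A u \<bullet> J3 v = 0" "B u \<bullet> J2 v = 0" "B u \<bullet> J3 v = 0"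
    "B v \<bullet> J2 v = s * (A v \<bullet> J3 v)" "B v \<bullet> J3 v = - s * (A v \<bullet> J2 v)"
    "B u \<bullet> v = s * (A u \<bullet> J1 v)" "B u \<bullet> J1 v = - s * (A u \<bullet> v)"
    "(A v \<bullet> J2 v)\<^sup>2 + (A v \<bullet> J3 v)\<^sup>2 = 1/10" "(A u \<bullet> v)\<^sup>2 + (A u \<bullet> J1 v)\<^sup>2 = 3/40"
    by (rule root_analysis[OF lm \<nu>0 bi' roots]) (rule that)
  define r where "r = Complex (A v \<bullet> J2 v) (A v \<bullet> J3 v)"
  define q where "q = Complex (A u \<bullet> v) (A u \<bullet> J1 v)"
  have r2: "r * cnj r = 1/10" and q2: "q * cnj q = 3/40"
    using s(16,17) by (simp_all add: r_def q_def complex_eq_iff power2_eq_square)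
  have q0: "q \<noteq> 0" using q2 by auto
  define t where "t = complex_of_real (sqrt 3)"
  have t2: "t * t = 3" and ct: "cnj t = t" by (simp_all add: t_def flip: of_real_mult)
  \<comment> \<open>The phase that aligns \<open>q\<close> with \<open>r\<close>. It has modulus 1
    because the squared moduli 3/40 and 1/10 have ratio 3/4, the square of sqrt 3 / 2.\<close>
  define z where "z = - (t / 2) * r / q"
  have qz: "q * z = - (t / 2) * r" using q0 by (simp add: z_def)
  have "(q * cnj q) * (z * cnj z) = (q * z) * cnj (q * z)" by simp
  also have "\<dots> = (t * t) / 4 * (r * cnj r)" unfolding qz by (simp add: ct)
  finally have zz: "z * cnj z = 1" unfolding q2 r2 t2 by simp
  then have "complex_of_real ((cmod z)\<^sup>2) = 1" using complex_norm_square[of z] by simp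
  then have "(cmod z)\<^sup>2 = 1" by (simp only: of_real_eq_1_iff)
  then have cz: "cmod z = 1" by (simp add: abs_square_eq_1)
  have gK: "S_cpx K x y z w = S_cpx (frob_form S) x y z w" for x y z w
    by (simp add: S_cpx_def form)
  have main: "S_cpx K X X X X = discr_quartic x1 x2 x3 x4" if X: "X = frame_comb (J1_scale z u) v x1 x2 x3 x4"
    for X x1 x2 x3 x4
  proof -
    define y1 y3 where "y1 = x1 * z" and "y3 = x3 * cnj z"
    have X: "X = frame_comb u v y1 x2 y3 x4" unfolding X frame_comb_J1_scale y1_def y3_def ..
    \<comment> \<open>The forms of \<open>A\<close> and \<open>B\<close> are \<open>E + E'\<close>
      and \<open>- \<i> * s * (E - E')\<close>, so their squares add up to
      \<open>4 * (E * E')\<close> for either sign \<open>s\<close>.\<close>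
    define E E' where "E = r * x2\<^sup>2 - 2 * q * y1 * x4" and "E' = cnj r * x4\<^sup>2 + 2 * cnj q * x2 * y3"
    have Cr: "Complex (A v \<bullet> J2 v) (- (A v \<bullet> J3 v)) = cnj r" "Complex (A u \<bullet> v) (- (A u \<bullet> J1 v)) = cnj q"
      by (simp_all add: r_def q_def complex_eq_iff)
    have CB: "Complex (B v \<bullet> J2 v) (B v \<bullet> J3 v) = - \<i> * of_real s * r"
      "Complex (B v \<bullet> J2 v) (- (B v \<bullet> J3 v)) = \<i> * of_real s * cnj r"
      "Complex (B u \<bullet> v) (B u \<bullet> J1 v) = - \<i> * of_real s * q"
      "Complex (B u \<bullet> v) (- (B u \<bullet> J1 v)) = \<i> * of_real s * cnj q"
      by (simp_all add: r_def q_def s complex_eq_iff)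
    have C0: "Complex 0 0 = 0" by (simp add: complex_eq_iff)
    have qH: "quad_form H X X = - 2 * \<i> * of_real m * (3 * (y1 * y3) + x2 * x4)"
      unfolding X quad_form_frame_comb[OF sp(1)] by (simp add: Hu Hv fi C0 s(2) algebra_simps)
    have QH: "quad_form H X X * quad_form H X X = - (4 * of_real (m\<^sup>2)) * (3 * (y1 * y3) + x2 * x4)\<^sup>2"
      unfolding qH by (simp add: power2_eq_square algebra_simps)
    have qA: "quad_form A X X = E + E'"
      unfolding X quad_form_frame_comb[OF sp(2)] Cr r_def[symmetric] q_def[symmetric]
      by (simp add: s C0 p1 E_def E'_def power2_eq_square algebra_simps)
    have qB: "quad_form B X X = - \<i> * of_real s * (E - E')"
      unfolding X quad_form_frame_comb[OF sp(3)] CB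
      by (simp only: s(6,7,10,11) p1 minus_zero C0) (simp add: E_def E'_def power2_eq_square algebra_simps)
    have sq: "- \<i> * of_real s * (E - E') * (- \<i> * of_real s * (E - E')) = - of_real (s * s) * ((E - E') * (E - E'))"
      by (simp add: algebra_simps)
    have QAB: "quad_form A X X * quad_form A X X + quad_form B X X * quad_form B X X = 4 * (E * E')"
      unfolding qA qB sq s(1) by (simp add: algebra_simps)
    have "S_cpx K X X X X = 10 * (quad_form H X X * quad_form H X X + (quad_form A X X * quad_form A X X + quad_form B X X * quad_form B X X))"
      unfolding gK S_cpx_frob_form sumS symp_form_self by (simp add: add.assoc)
    \<comment> \<open>Here \<open>10 * 4 * m^2 = 1\<close> gives the coefficient of the square
      coming from \<open>H\<close>.\<close>
    also have "\<dots> = - (3 * (y1 * y3) + x2 * x4)\<^sup>2 + 40 * (E * E')"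
      unfolding QH QAB s(3) by simp
    also have "E = r * (x2\<^sup>2 + t * x1 * x4)"
    proof -
      have "E = r * x2\<^sup>2 - 2 * (q * z) * x1 * x4" by (simp add: E_def y1_def algebra_simps)
      then show ?thesis unfolding qz by (simp add: algebra_simps)
    qed
    also have "E' = cnj r * (x4\<^sup>2 - t * x2 * x3)"
    proof -
      have "E' = cnj r * x4\<^sup>2 + 2 * cnj (q * z) * x2 * x3" by (simp add: E'_def y3_def algebra_simps)
      then show ?thesis unfolding qz by (simp add: ct algebra_simps)
    qed
    also have "y1 * y3 = x1 * x3" using zz by (simp add: y1_def y3_def mult_ac)
    also have "40 * (r * (x2\<^sup>2 + t * x1 * x4) * (cnj r * (x4\<^sup>2 - t * x2 * x3))) =
        40 * (r * cnj r) * ((x2\<^sup>2 + t * x1 * x4) * (x4\<^sup>2 - t * x2 * x3))"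
      by (simp add: mult_ac)
    also have "- (3 * (x1 * x3) + x2 * x4)\<^sup>2 + \<dots> = discr_quartic x1 x2 x3 x4"
    proof -
      have "t * (t * y) = 3 * y" for y by (simp add: t2 flip: mult.assoc)
      then show ?thesis
        unfolding r2 discr_quartic_def t_def[symmetric]
        by (simp add: power2_eq_square power3_eq_cube algebra_simps)
    qed
    finally show ?thesis .
  qed
  show ?thesis
    unfolding discr_curv_iff[OF dim K] Let_def
    using J1_scale_frame[OF fr cz] main by blast
qed

end

theorem theorem3p4:
  fixes J1 J2 J3 :: "'v::euclidean_space \<Rightarrow>\<^sub>L 'v"
    and K :: "'v \<Rightarrow> 'v \<Rightarrow> 'v \<Rightarrow> 'v \<Rightarrow> real"
  assumes "DIM('v) = 8"
    and "hyper_hermitian J1 J2 J3"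
    and "K \<in> curv_sp2 J1 J2 J3"
  shows "K \<in> discr_curv J1 J2 J3 \<longleftrightarrow>
    (\<forall>A \<in> sp2 J1 J2 J3.
       let B = 2 *\<^sub>R curv_op K A + 3 *\<^sub>R A in 2 *\<^sub>R curv_op K B - 7 *\<^sub>R B = 0) \<and>
    (\<forall>A \<in> sp2 J1 J2 J3. \<forall>B \<in> sp2 J1 J2 J3.
       bracket (curv_op K A) (curv_op K B) - curv_op K (bracket (curv_op K A) B) =
       (3/2) *\<^sub>R (curv_op K (bracket A B) - bracket A (curv_op K B)))"
proof -
  interpret hyper_hermitian_space J1 J2 J3
    by unfold_locales (fact assms(2))
  show ?thesis
    using conditions_imp_discr_curv[OF assms(1,3)] discr_curv_imp_conditions[OF assms(1,3)] by blast
qed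

end
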